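(* Let $\mathcal{A}$ be a unital $C^*$-algebra, let $\mathcal{F}\subseteq\mathcal{A}$ be an ideal of finite type elements, and let $F\in B(\mathcal{A})$ belong to $\mathcal{M}\mathcal{K}\Phi(\mathcal{A})$. Then the index of $F$ is well defined: if $$\mathcal{A}=M_1\tilde\oplus N_1\stackrel{F}{\longrightarrow}M_2\tilde\oplus N_2=\mathcal{A}\quad\text{and}\quad \mathcal{A}=M_1'\tilde\oplus N_1'\stackrel{F}{\longrightarrow}M_2'\tilde\oplus N_2'=\mathcal{A}$$ are any two $\mathcal{M}\mathcal{K}\Phi$-decompositions for $F$, then $$[P_{N_1}]-[P_{N_2}]=[P_{N_1'}]-[P_{N_2'}]\quad\text{in } K(\mathcal{F}).$$
   Context: $\mathcal{A}$ is regarded as a right Hilbert $C^*$-module over itself with $\langle x,y\rangle=x^*y$. $B(\mathcal{A})$ is the $C^*$-algebra of bounded $\mathcal{A}$-linear operators on $\mathcal{A}$ (all are adjointable); it is identified with $\mathcal{A}$ via $a\mapsto L_a$ (left multiplication), so elements and ideals of $\mathcal{A}$ are also regarded as elements and ideals of $B(\mathcal{A})$. Ideal of finite type elements: a subalgebra $\mathcal{F}\subseteq\mathcal{A}$ (not assumed closed) such that (i) $\mathcal{F}$ is a selfadjoint two-sided ideal of $\mathcal{A}$; (ii) $\mathcal{F}$ has an approximate unit consisting of projections, i.e. an increasing net $(p_\alpha)$ of projections in $\mathcal{F}$ with $\|p_\alpha a-a\|\to0$ and $\|ap_\alpha-a\|\to0$ for all $a\in\mathcal{F}$; (iii) for all projections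 $p,q\in\mathcal{F}$ there is $v\in\mathcal{A}$ with $vv^*=q$ and $v^*v\perp p$ (i.e. $v^*v+p$ is a projection). $K(\mathcal{F})$: on the set $\mathrm{Proj}(\mathcal{F})$ of (orthogonal) projections in $\mathcal{F}$ put $p\sim q$ iff there is $v\in\mathcal{A}$ with $vv^*=p$, $v^*v=q$. The set $S(\mathcal{F})=\mathrm{Proj}(\mathcal{F})/\!\sim$ is a commutative semigroup under $[p]+[q]=[p'+q']$, where $p'\sim p$, $q'\sim q$ are mutually orthogonal projections in $\mathcal{F}$ (these exist by (iii)). $K(\mathcal{F})$ is the Grothendieck group of $S(\mathcal{F})$, and $[p]$ also denotes the class of $p$ in $K(\mathcal{F})$. Submodules: $M\tilde\oplus N=\mathcal{A}$ means $M,N$ are closed submodules with $M\cap N=\{0\}$, $M+N=\mathcal{A}$ (not necessarily orthogonal). A closed submodule $N$ of $\mathcal{A}$ is complementable if $M\tilde\oplus N=\mathcal{A}$ for some closed submodule $M$; every such $N$ is orthogonally complementable in $\mathcal{A}$, and $P_N\in B(\mathcal{A})$ denotes the orthogonal projection onto $N$. An isomorphism of Hilbert modules is a bounded $\mathcal{A}$-linear bijection. $\mathcal{M}\mathcal{K}\Phi(\mathcal{A})$: an $\mathcal{M}\mathcal{K}\Phi$-decomposition for $F\in B(\mathcal{A})$ is a pair of decompositions $\mathcal{A}=M_1\tilde\oplus N_1\stackrel{F}{\longrightarrow}M_2\tilde\oplus N_2=\mathcal{A}$ with respect to which $F$ has the matrix $\begin{pmatrix}F_1&0\\0&F_4\end{pmatrix}$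 with $F_1$ an isomorphism (i.e. $F$ maps $M_1$ isomorphically onto $M_2$ and $F(N_1)\subseteq N_2$), and such that $P_{N_1},P_{N_2}\in\mathcal{F}$. $F\in\mathcal{M}\mathcal{K}\Phi(\mathcal{A})$ means such a decomposition exists, and the index of $F$ is then $[P_{N_1}]-[P_{N_2}]\in K(\mathcal{F})$. *)

theory Defs
  imports "HOL-Analysis.Analysis" "HOL-Algebra.Group"
begin

section \<open>Unital C*-algebras\<close>

text \<open>
  The class is built on \<^class>\<open>monoid_mult\<close> instead of \<^class>\<open>real_normed_algebra_1\<close> so that the
  zero algebra is not excluded. If \<open>1 \<noteq> 0\<close>, then \<open>norm 1 = 1\<close> follows from the C*-identity.
\<close>

class unital_cstar_algebra = real_normed_algebra + banach + monoid_mult +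
  fixes scaleC :: "complex \<Rightarrow> 'a \<Rightarrow> 'a" (infixr \<open>*\<^sub>C\<close> 75)
    and star :: "'a \<Rightarrow> 'a"
  assumes scaleC_add_right: "c *\<^sub>C (x + y) = c *\<^sub>C x + c *\<^sub>C y"
    and scaleC_add_left: "(c + d) *\<^sub>C x = c *\<^sub>C x + d *\<^sub>C x"
    and scaleC_scaleC: "c *\<^sub>C (d *\<^sub>C x) = (c * d) *\<^sub>C x"
    and scaleC_of_real: "complex_of_real r *\<^sub>C x = r *\<^sub>R x"
    and mult_scaleC_left: "(c *\<^sub>C x) * y = c *\<^sub>C (x * y)"
    and mult_scaleC_right: "x * (c *\<^sub>C y) = c *\<^sub>C (x * y)"
    and norm_scaleC: "norm (c *\<^sub>C x) = cmod c * norm x"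
    and star_star: "star (star x) = x"
    and star_add: "star (x + y) = star x + star y"
    and star_scaleC: "star (c *\<^sub>C x) = cnj c *\<^sub>C star x"
    and star_mult: "star (x * y) = star y * star x"
    and cstar_identity: "norm (star x * x) = (norm x)\<^sup>2"

definition is_projection :: "'a::unital_cstar_algebra \<Rightarrow> bool" where
  "is_projection p \<longleftrightarrow> p * p = p \<and> star p = p"

text \<open>For projections \<open>p\<close> and \<open>q\<close>, the sum is a projection iff \<open>p * q = 0\<close>.\<close>

definition orthogonal_projections :: "'a::unital_cstar_algebra \<Rightarrow> 'a \<Rightarrow> bool" where
  "orthogonal_projections p q \<longleftrightarrow> is_projection p \<and> is_projection q \<and> is_projection (p + q)"

definition cstar_le :: "'a::unital_cstar_algebra \<Rightarrow> 'a \<Rightarrow> bool" where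
  "cstar_le a b \<longleftrightarrow> (\<exists>c. b - a = star c * c)"


section \<open>Ideals of finite type elements\<close>

definition selfadjoint_ideal :: "'a::unital_cstar_algebra set \<Rightarrow> bool" where
  "selfadjoint_ideal \<F> \<longleftrightarrow>
     0 \<in> \<F> \<and> (\<forall>x\<in>\<F>. \<forall>y\<in>\<F>. x + y \<in> \<F>) \<and> (\<forall>c. \<forall>x\<in>\<F>. c *\<^sub>C x \<in> \<F>) \<and>
     (\<forall>x\<in>\<F>. \<forall>a. a * x \<in> \<F> \<and> x * a \<in> \<F>) \<and> (\<forall>x\<in>\<F>. star x \<in> \<F>)"

definition directed_on :: "'i set \<Rightarrow> ('i \<Rightarrow> 'i \<Rightarrow> bool) \<Rightarrow> bool" where
  "directed_on I leq \<longleftrightarrow> I \<noteq> {} \<and> (\<forall>i\<in>I. leq i i) \<and>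
     (\<forall>i\<in>I. \<forall>j\<in>I. \<forall>k\<in>I. leq i j \<longrightarrow> leq j k \<longrightarrow> leq i k) \<and>
     (\<forall>i\<in>I. \<forall>j\<in>I. \<exists>k\<in>I. leq i k \<and> leq j k)"

definition net_tendsto_zero :: "'i set \<Rightarrow> ('i \<Rightarrow> 'i \<Rightarrow> bool) \<Rightarrow> ('i \<Rightarrow> real) \<Rightarrow> bool" where
  "net_tendsto_zero I leq f \<longleftrightarrow> (\<forall>\<epsilon>>0. \<exists>i\<^sub>0\<in>I. \<forall>i\<in>I. leq i\<^sub>0 i \<longrightarrow> \<bar>f i\<bar> < \<epsilon>)"

definition projection_approximate_unit ::
  "'a::unital_cstar_algebra set \<Rightarrow> 'i set \<Rightarrow> ('i \<Rightarrow> 'i \<Rightarrow> bool) \<Rightarrow> ('i \<Rightarrow> 'a) \<Rightarrow> bool" where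
  "projection_approximate_unit \<F> I leq p \<longleftrightarrow>
     directed_on I leq \<and>
     (\<forall>i\<in>I. p i \<in> \<F> \<and> is_projection (p i)) \<and>
     (\<forall>i\<in>I. \<forall>j\<in>I. leq i j \<longrightarrow> cstar_le (p i) (p j)) \<and>
     (\<forall>a\<in>\<F>. net_tendsto_zero I leq (\<lambda>i. norm (p i * a - a)) \<and>
             net_tendsto_zero I leq (\<lambda>i. norm (a * p i - a)))"

text \<open>
  The index set of the approximate unit is a directed set in the arbitrary type \<open>'i\<close>. The type is
  passed as an argument because HOL cannot quantify existentially over types.
\<close>

definition finite_type_ideal :: "'i itself \<Rightarrow> 'a::unital_cstar_algebra set \<Rightarrow> bool" where
  "finite_type_ideal (ty :: 'i itself) \<F> \<longleftrightarrow>
     selfadjoint_ideal \<F> \<and>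
     (\<exists>(I :: 'i set) leq p. projection_approximate_unit \<F> I leq p) \<and>
     (\<forall>p\<in>\<F>. \<forall>q\<in>\<F>. is_projection p \<longrightarrow> is_projection q \<longrightarrow>
        (\<exists>v. v * star v = q \<and> orthogonal_projections (star v * v) p))"


section \<open>The Grothendieck group of a commutative semigroup\<close>

text \<open>The semigroup has carrier \<open>S\<close> and operation \<open>add\<close>; a pair \<open>(a, b)\<close> stands for \<open>[a] - [b]\<close>.\<close>

definition grothendieck_rel :: "'b set \<Rightarrow> ('b \<Rightarrow> 'b \<Rightarrow> 'b) \<Rightarrow> (('b \<times> 'b) \<times> ('b \<times> 'b)) set" where
  "grothendieck_rel S add =
     {((a, b), (c, d)). a \<in> S \<and> b \<in> S \<and> c \<in> S \<and> d \<in> S \<and>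
        (\<exists>e\<in>S. add (add a d) e = add (add c b) e)}"

definition grothendieck_group :: "'b set \<Rightarrow> ('b \<Rightarrow> 'b \<Rightarrow> 'b) \<Rightarrow> ('b \<times> 'b) set monoid" where
  "grothendieck_group S add =
     \<lparr>carrier = (S \<times> S) // grothendieck_rel S add,
      mult = (\<lambda>X Y. \<Union>(a, b)\<in>X. \<Union>(c, d)\<in>Y. grothendieck_rel S add `` {(add a c, add b d)}),
      one = (\<Union>s\<in>S. grothendieck_rel S add `` {(s, s)})\<rparr>"

text \<open>\<open>[s]\<close> is written as \<open>[s + s] - [s]\<close>, since a semigroup need not have a zero.\<close>

definition grothendieck_class :: "'b set \<Rightarrow> ('b \<Rightarrow> 'b \<Rightarrow> 'b) \<Rightarrow> 'b \<Rightarrow> ('b \<times> 'b) set" where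
  "grothendieck_class S add s = grothendieck_rel S add `` {(add s s, s)}"


section \<open>The group \<open>K(\<F>)\<close>\<close>

definition Proj :: "'a::unital_cstar_algebra set \<Rightarrow> 'a set" where
  "Proj \<F> = {p \<in> \<F>. is_projection p}"

definition proj_equiv :: "'a::unital_cstar_algebra set \<Rightarrow> ('a \<times> 'a) set" where
  "proj_equiv \<F> = {(p, q). p \<in> Proj \<F> \<and> q \<in> Proj \<F> \<and> (\<exists>v. v * star v = p \<and> star v * v = q)}"

definition S_carrier :: "'a::unital_cstar_algebra set \<Rightarrow> 'a set set" where
  "S_carrier \<F> = Proj \<F> // proj_equiv \<F>"

text \<open>
  The union runs over all orthogonal representatives \<open>p \<in> X\<close>, \<open>q \<in> Y\<close>; all of them give the same
  class \<open>[p + q]\<close>.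
\<close>

definition S_add :: "'a::unital_cstar_algebra set \<Rightarrow> 'a set \<Rightarrow> 'a set \<Rightarrow> 'a set" where
  "S_add \<F> X Y = (\<Union>p\<in>X. \<Union>q\<in>{q \<in> Y. orthogonal_projections p q}. proj_equiv \<F> `` {p + q})"

definition K_group :: "'a::unital_cstar_algebra set \<Rightarrow> ('a set \<times> 'a set) set monoid" where
  "K_group \<F> = grothendieck_group (S_carrier \<F>) (S_add \<F>)"

definition K_class :: "'a::unital_cstar_algebra set \<Rightarrow> 'a \<Rightarrow> ('a set \<times> 'a set) set" where
  "K_class \<F> p = grothendieck_class (S_carrier \<F>) (S_add \<F>) (proj_equiv \<F> `` {p})"


section \<open>The algebra as a Hilbert module over itself\<close>

definition module_inner :: "'a::unital_cstar_algebra \<Rightarrow> 'a \<Rightarrow> 'a" where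
  "module_inner x y = star x * y"

definition module_operators :: "('a::unital_cstar_algebra \<Rightarrow> 'a) set" where
  "module_operators =
     {T. bounded_linear T \<and> (\<forall>c x. T (c *\<^sub>C x) = c *\<^sub>C T x) \<and> (\<forall>x a. T (x * a) = T x * a)}"

definition left_mult :: "'a::unital_cstar_algebra \<Rightarrow> 'a \<Rightarrow> 'a" where
  "left_mult a = (\<lambda>x. a * x)"

text \<open>Closure under complex scalars follows from closure under right multiplication by \<open>c *\<^sub>C 1\<close>.\<close>

definition closed_submodule :: "'a::unital_cstar_algebra set \<Rightarrow> bool" where
  "closed_submodule M \<longleftrightarrow>
     closed M \<and> 0 \<in> M \<and> (\<forall>x\<in>M. \<forall>y\<in>M. x + y \<in> M) \<and> (\<forall>x\<in>M. \<forall>a. x * a \<in> M)"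

definition direct_decomposition :: "'a::unital_cstar_algebra set \<Rightarrow> 'a set \<Rightarrow> bool" where
  "direct_decomposition M N \<longleftrightarrow>
     closed_submodule M \<and> closed_submodule N \<and> M \<inter> N = {0} \<and> {m + n | m n. m \<in> M \<and> n \<in> N} = UNIV"

text \<open>
  \<open>orth_proj N\<close> is \<open>P\<^sub>N\<close>, meaningful only for an orthogonally complementable submodule \<open>N\<close>; such a
  projection is unique.
\<close>

definition orth_proj :: "'a::unital_cstar_algebra set \<Rightarrow> 'a \<Rightarrow> 'a" where
  "orth_proj N =
     (THE P. P \<in> module_operators \<and>
        (\<forall>x. P x \<in> N \<and> (\<forall>y\<in>N. module_inner y (x - P x) = 0)))"

text \<open>The element \<open>a\<close> of the algebra that is identified with the operator \<open>T = left_mult a\<close>.\<close>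

definition operator_element :: "('a::unital_cstar_algebra \<Rightarrow> 'a) \<Rightarrow> 'a" where
  "operator_element T = the_inv left_mult T"


section \<open>MK\<open>\<Phi>\<close>-operators\<close>

text \<open>
  \<open>bij_betw F M\<^sub>1 M\<^sub>2\<close> says that \<open>F\<close> restricts to an isomorphism \<open>M\<^sub>1 \<rightarrow> M\<^sub>2\<close> of Hilbert modules,
  since \<open>F\<close> itself is bounded and linear over the algebra.
\<close>

definition MKPhi_decomposition ::
  "'a::unital_cstar_algebra set \<Rightarrow> ('a \<Rightarrow> 'a) \<Rightarrow> 'a set \<Rightarrow> 'a set \<Rightarrow> 'a set \<Rightarrow> 'a set \<Rightarrow> bool" where
  "MKPhi_decomposition \<F> F M\<^sub>1 N\<^sub>1 M\<^sub>2 N\<^sub>2 \<longleftrightarrow>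
     direct_decomposition M\<^sub>1 N\<^sub>1 \<and> direct_decomposition M\<^sub>2 N\<^sub>2 \<and>
     bij_betw F M\<^sub>1 M\<^sub>2 \<and> F ` N\<^sub>1 \<subseteq> N\<^sub>2 \<and>
     orth_proj N\<^sub>1 \<in> left_mult ` \<F> \<and> orth_proj N\<^sub>2 \<in> left_mult ` \<F>"

definition MKPhi :: "'a::unital_cstar_algebra set \<Rightarrow> ('a \<Rightarrow> 'a) set" where
  "MKPhi \<F> = {F \<in> module_operators. \<exists>M\<^sub>1 N\<^sub>1 M\<^sub>2 N\<^sub>2. MKPhi_decomposition \<F> F M\<^sub>1 N\<^sub>1 M\<^sub>2 N\<^sub>2}"

text \<open>\<open>[P] - [Q]\<close> for the projections \<open>P\<close>, \<open>Q\<close> onto \<open>N\<^sub>1\<close>, \<open>N\<^sub>2\<close>;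
  the group operation of the record \<^const>\<open>K_group\<close> is addition in \<open>K(\<F>)\<close>.\<close>

definition MKPhi_index ::
  "'a::unital_cstar_algebra set \<Rightarrow> 'a set \<Rightarrow> 'a set \<Rightarrow> ('a set \<times> 'a set) set" where
  "MKPhi_index \<F> N\<^sub>1 N\<^sub>2 =
     K_class \<F> (operator_element (orth_proj N\<^sub>1))
       \<otimes>\<^bsub>K_group \<F>\<^esub> inv\<^bsub>K_group \<F>\<^esub> K_class \<F> (operator_element (orth_proj N\<^sub>2))"

end

theory Submission
  imports Defs
begin

text \<open>
  A decomposition for \<open>F = left_mult f\<close> amounts to idempotents \<open>e\<^sub>1, e\<^sub>2 \<in> \<F>\<close> with ranges \<open>N\<^sub>1, N\<^sub>2\<close> and
  an element \<open>g\<close> with \<open>g f = 1 - e\<^sub>1\<close> and \<open>f g = 1 - e\<^sub>2\<close>. For a projection \<open>p\<close> far out in the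
  approximate unit, \<open>f\<close> is bounded below on \<open>(1 - p) \<A>\<close>. If \<open>k \<in> \<F>\<close> is an idempotent whose kernel is
  \<open>f (1 - p) \<A>\<close>, then \<open>[p] = [d] + [e\<^sub>1]\<close> and \<open>[k] = [d] + [e\<^sub>2]\<close> for some idempotent \<open>d \<in> \<F>\<close>, so
  the index is \<open>[p] - [k]\<close>. The class of \<open>k\<close> depends only on \<open>f\<close> and \<open>p\<close>, and \<open>p\<close> can be chosen to work
  for both decompositions. Passing from idempotents to projections, and from algebraic equivalence
  to equivalence by partial isometries, takes some functional calculus, which is obtained from
  Banach's fixed point theorem.
\<close>

section \<open>Elementary C*-algebra theory\<close>

lemma star_1 [simp]: "star (1::'a::unital_cstar_algebra) = 1"
  by (metis mult.left_neutral star_mult star_star)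

lemma star_0 [simp]: "star (0::'a::unital_cstar_algebra) = 0"
  using star_add[of "0::'a" 0] by simp

lemma star_minus [simp]: "star (- x) = - star (x::'a::unital_cstar_algebra)"
  using star_add[of x "- x"] by (simp add: eq_neg_iff_add_eq_0 add.commute)

lemma star_diff: "star (x - y) = star x - star (y::'a::unital_cstar_algebra)"
  using star_add[of x "- y"] by simp

lemma star_scaleR [simp]: "star (r *\<^sub>R x) = r *\<^sub>R star (x::'a::unital_cstar_algebra)"
  by (metis star_scaleC scaleC_of_real complex_cnj_complex_of_real)

lemma scaleC_one [simp]: "1 *\<^sub>C x = (x::'a::unital_cstar_algebra)"
  using scaleC_of_real[of 1 x] by simp

lemma scaleC_minus_left: "(- c) *\<^sub>C x = - (c *\<^sub>C (x::'a::unital_cstar_algebra))"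
proof -
  have "(- 1) *\<^sub>C y = - y" for y :: 'a
    using scaleC_of_real[of "- 1" y] by simp
  then show ?thesis
    by (metis scaleC_scaleC mult_minus1)
qed

lemma scaleC_diff_right: "c *\<^sub>C (x - y) = c *\<^sub>C x - c *\<^sub>C (y::'a::unital_cstar_algebra)"
  using scaleC_add_right[of c "x - y" y] by (simp add: eq_diff_eq)

lemma norm_le_norm_star: "norm x \<le> norm (star (x::'a::unital_cstar_algebra))"
proof (cases "x = 0")
  case False
  have "norm x * norm x \<le> norm (star x) * norm x"
    using norm_mult_ineq[of "star x" x] by (simp add: cstar_identity power2_eq_square)
  then show ?thesis
    using False by simp
qed simp

lemma norm_star [simp]: "norm (star x) = norm (x::'a::unital_cstar_algebra)"
  using norm_le_norm_star[of x] norm_le_norm_star[of "star x"] by (simp add: star_star)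

lemma bounded_linear_star: "bounded_linear (star :: 'a::unital_cstar_algebra \<Rightarrow> 'a)"
  by (rule bounded_linear_intro[where K = 1]) (auto simp: star_add)

lemma star_mult_self_eq_0: "star x * x = 0 \<Longrightarrow> (x::'a::unital_cstar_algebra) = 0"
  using cstar_identity[of x] by simp

text \<open>The inequality form covers the zero algebra, where \<open>norm 1 = 0\<close>.\<close>

lemma norm_one_le: "norm (1::'a::unital_cstar_algebra) \<le> 1"
proof (cases "norm (1::'a) = 0")
  case False
  then show ?thesis
    using cstar_identity[of "1::'a"] by (simp add: power2_eq_square)
qed simp

section \<open>Inverses, square roots and absolute values from contractions\<close>

text \<open>The affine maps \<open>1 + c * x\<close> and \<open>1 + x * c\<close> contract with
  factor \<open>norm c\<close>; their fixed points are a right and a left inverse, which therefore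
  coincide.\<close>

lemma ex_inverse_one_minus:
  fixes c :: "'a::unital_cstar_algebra"
  assumes "norm c < 1"
  obtains s where "s * (1 - c) = 1" "(1 - c) * s = 1"
proof -
  have "\<exists>!x. 1 + c * x = x"
  proof (rule banach_fix_type[of "norm c"])
    show "\<forall>x y. dist (1 + c * x) (1 + c * y) \<le> norm c * dist x y"
      by (metis add_diff_cancel_left dist_norm norm_mult_ineq right_diff_distrib)
  qed (use assms in auto)
  then obtain x where x: "1 + c * x = x" by auto
  have "\<exists>!x. 1 + x * c = x"
  proof (rule banach_fix_type[of "norm c"])
    show "\<forall>x y. dist (1 + x * c) (1 + y * c) \<le> norm c * dist x y"
      by (metis add_diff_cancel_left dist_norm norm_mult_ineq left_diff_distrib mult.commute)
  qed (use assms in auto)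
  then obtain y where y: "1 + y * c = y" by auto
  have 1: "(1 - c) * x = 1"
    using x by (simp add: algebra_simps)
  have 2: "y * (1 - c) = 1"
    using y by (simp add: algebra_simps)
  have "y = x"
    by (metis 1 2 mult.assoc mult.left_neutral mult.right_neutral)
  with 1 2 that show ?thesis by blast
qed

text \<open>The square root is \<open>1 - x\<close>, where \<open>x\<close> is the fixed point of \<open>x \<mapsto> (c + x\<^sup>2) / 2\<close>.\<close>

lemma ex_sqrt_one_minus:
  fixes c :: "'a::unital_cstar_algebra"
  assumes c: "norm c < 1" and sa: "star c = c"
  obtains s where "s * s = 1 - c" "star s = s" "\<And>y. y * c = c * y \<Longrightarrow> y * s = s * y"
proof -
  \<comment> \<open>Self-adjointness and commutation with everything that commutes with
    \<open>c\<close> are closed conditions preserved by \<open>\<phi>\<close>; putting them into the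
    domain lets the fixed point inherit them.\<close>
  define X where "X = cball 0 (norm c) \<inter> {x. star x = x} \<inter> (\<Inter>y\<in>{y. y * c = c * y}. {x. y * x = x * y})"
  define \<phi> where "\<phi> x = (1/2) *\<^sub>R (c + x * x)" for x
  have "closed {x::'a. star x = x}"
    by (intro closed_Collect_eq continuous_intros linear_continuous_on bounded_linear_star)
  moreover have "closed {x::'a. y * x = x * y}" for y
    by (intro closed_Collect_eq continuous_intros)
  ultimately have "closed X"
    unfolding X_def by (intro closed_Int closed_INT closed_cball ballI) auto
  have X: "norm x \<le> norm c" "star x = x" "y * c = c * y \<Longrightarrow> y * x = x * y" if "x \<in> X" for x y
    using that unfolding X_def by auto
  have n: "norm (\<phi> x) \<le> norm c" if "norm x \<le> norm c" for x
  proof -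
    have "norm (x * x) \<le> norm x * norm x"
      by (rule norm_mult_ineq)
    also have "\<dots> \<le> norm c * norm c"
      using that by (intro mult_mono) auto
    also have "\<dots> \<le> norm c"
      using c by (simp add: mult_left_le)
    finally show ?thesis
      unfolding \<phi>_def using norm_triangle_ineq[of c "x * x"] by simp
  qed
  have "\<exists>!x\<in>X. \<phi> x = x"
  proof (rule Banach_fix[where c = "norm c"])
    show "complete X"
      using \<open>closed X\<close> by (simp add: complete_eq_closed)
    show "X \<noteq> {}"
      proof -
      have "0 \<in> X" by (simp add: X_def)
      then show ?thesis by blast
    qed
    show "\<phi> ` X \<subseteq> X"
    proof (clarify)
      fix x assume x: "x \<in> X"
      have comm: "y * \<phi> x = \<phi> x * y" if "y * c = c * y" for y
      proof -
        have "y * x = x * y"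
          using x that by (rule X(3))
        then have "y * (x * x) = x * x * y"
          by (metis mult.assoc)
        then show ?thesis
          using that by (simp add: \<phi>_def algebra_simps)
      qed
      have "star (\<phi> x) = \<phi> x"
        using X(2)[OF x] by (simp add: \<phi>_def star_add star_mult sa)
      moreover have "\<phi> x \<in> cball 0 (norm c)"
        using n X(1)[OF x] by simp
      ultimately show "\<phi> x \<in> X"
        using comm unfolding X_def by blast
    qed
    show "dist (\<phi> x) (\<phi> y) \<le> norm c * dist x y" if "x \<in> X" "y \<in> X" for x y
    proof -
      have "x * x - y * y = x * (x - y) + (x - y) * y"
        by (simp add: algebra_simps)
      then have "norm (x * x - y * y) \<le> norm x * norm (x - y) + norm (x - y) * norm y"
        by (simp only:) (intro norm_triangle_mono norm_mult_ineq)
      also have "\<dots> \<le> norm c * norm (x - y) + norm (x - y) * norm c"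
        using that by (intro add_mono mult_mono X) auto
      finally have "norm (x * x - y * y) \<le> 2 * (norm c * norm (x - y))"
        by simp
      moreover have "\<phi> x - \<phi> y = (1/2) *\<^sub>R (x * x - y * y)"
        by (simp add: \<phi>_def algebra_simps)
      ultimately show ?thesis
        by (simp add: dist_norm)
    qed
  qed (use c in auto)
  then obtain x where x: "x \<in> X" "\<phi> x = x" by blast
  have "c + x * x = 2 *\<^sub>R \<phi> x"
    by (simp add: \<phi>_def)
  then have "x * x = 2 *\<^sub>R x - c"
    by (simp add: x eq_diff_eq add.commute)
  then have "(1 - x) * (1 - x) = 1 - c"
    by (simp add: algebra_simps scaleR_2)
  moreover have "star (1 - x) = 1 - x"
    using X(2) x by (simp add: star_diff)
  moreover have "y * (1 - x) = (1 - x) * y" if "y * c = c * y" for y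
    using X(3)[OF x(1) that] by (simp add: algebra_simps)
  ultimately show ?thesis
    using that by blast
qed

text \<open>With \<open>s = sqrt (1 - h\<^sup>2)\<close>, the element \<open>h + \<i> s\<close> is unitary, so its imaginary part \<open>s\<close> has norm at most 1.\<close>

lemma norm_one_minus_square_le:
  fixes h :: "'a::unital_cstar_algebra"
  assumes "norm h < 1" and sa: "star h = h"
  shows "norm (1 - h * h) \<le> 1"
proof -
  have "norm (h * h) < 1"
    using cstar_identity[of h] assms by (simp add: power_less_one_iff)
  moreover have "star (h * h) = h * h"
    by (simp add: star_mult sa)
  ultimately obtain s where s: "s * s = 1 - h * h" "star s = s"
      "\<And>y. y * (h * h) = h * h * y \<Longrightarrow> y * s = s * y"
    by (rule ex_sqrt_one_minus) blast
  have comm: "h * s = s * h"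
    by (rule s(3)) (simp add: mult.assoc)
  define u where "u = h + \<i> *\<^sub>C s"
  have su: "star u = h - \<i> *\<^sub>C s"
    by (simp add: u_def star_add star_scaleC sa s(2) scaleC_minus_left)
  have "star u * u = h * h - \<i> *\<^sub>C (\<i> *\<^sub>C (s * s))"
    unfolding su by (simp add: u_def algebra_simps mult_scaleC_left mult_scaleC_right scaleC_diff_right comm)
  also have "\<dots> = 1"
    by (simp add: scaleC_scaleC scaleC_minus_left s(1))
  finally have "(norm u)\<^sup>2 \<le> 1"
    using cstar_identity[of u] norm_one_le[where 'a='a] by simp
  then have u: "norm u \<le> 1"
    by (simp add: power_le_one_iff)
  have "2 *\<^sub>R (\<i> *\<^sub>C s) = u - star u"
    unfolding su by (simp add: u_def scaleR_2)
  moreover have "norm (2 *\<^sub>R (\<i> *\<^sub>C s)) = 2 * norm s"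
    by (simp add: norm_scaleC)
  ultimately have "2 * norm s = norm (u - star u)"
    by simp
  also have "\<dots> \<le> 2"
    using norm_triangle_ineq4[of u "star u"] u by simp
  finally have "norm s \<le> 1"
    by simp
  then have "norm (s * s) \<le> 1"
    using cstar_identity[of s] unfolding s(2) by (simp add: power_le_one)
  then show ?thesis
    unfolding s(1) .
qed

text \<open>Rescaling by \<open>sqrt t\<close> reduces this to
  \<open>norm_one_minus_square_le\<close>. The estimate stands in for the spectral fact that
  \<open>h * h\<close> is positive.\<close>

lemma norm_minus_square_le:
  fixes h :: "'a::unital_cstar_algebra"
  assumes sa: "star h = h" and t: "(norm h)\<^sup>2 < t"
  shows "norm (t *\<^sub>R 1 - h * h) \<le> t"
proof -
  have t0: "t > 0"
    using t by (meson le_less_trans zero_le_power2)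
  define k where "k = (1 / sqrt t) *\<^sub>R h"
  have "norm h < sqrt t"
    using t by (rule real_less_rsqrt)
  then have "norm k < 1"
    using t0 by (simp add: k_def)
  moreover have "star k = k"
    by (simp add: k_def sa)
  ultimately have "norm (1 - k * k) \<le> 1"
    by (rule norm_one_minus_square_le)
  moreover have "t *\<^sub>R 1 - h * h = t *\<^sub>R (1 - k * k)"
    using t0 by (simp add: k_def scaleR_diff_right)
  ultimately show ?thesis
    using t0 by (simp add: mult_left_le)
qed

text \<open>Up to the factor \<open>1 + t\<close>, the element is \<open>1 - c\<close> with
  \<open>norm c \<le> t / (1 + t)\<close>, so \<open>ex_inverse_one_minus\<close> applies.\<close>

lemma ex_inverse_one_plus_square:
  fixes h :: "'a::unital_cstar_algebra"
  assumes sa: "star h = h"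
  obtains s where "s * (1 + h * h) = 1" "(1 + h * h) * s = 1"
proof -
  define t where "t = (norm h)\<^sup>2 + 1"
  have t: "t > 0" "(norm h)\<^sup>2 < t"
    by (auto simp: t_def add_nonneg_pos)
  define c where "c = (1 / (1 + t)) *\<^sub>R (t *\<^sub>R 1 - h * h)"
  have "norm c < 1"
    using norm_minus_square_le[OF sa t(2)] t by (simp add: c_def divide_simps)
  then obtain s where s: "s * (1 - c) = 1" "(1 - c) * s = 1"
    by (rule ex_inverse_one_minus)
  have "(1 + t) *\<^sub>R (1 - c) = (1 + t) *\<^sub>R 1 - (t *\<^sub>R 1 - h * h)"
    using t by (simp add: c_def scaleR_diff_right)
  also have "\<dots> = 1 + h * h"
    by (simp add: algebra_simps)
  finally have *: "1 + h * h = (1 + t) *\<^sub>R (1 - c)" ..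
  show ?thesis
    by (rule that[of "(1 / (1 + t)) *\<^sub>R s"]) (unfold *, use t s in simp_all)
qed

text \<open>Here \<open>r\<close> is the absolute value of \<open>y\<close>. Invertibility keeps
  \<open>y * y\<close> away from zero: \<open>y * y - \<epsilon> *\<^sub>R 1\<close> is still the
  square of a self-adjoint element \<open>h\<close>, so a multiple of \<open>y * y\<close> lies at
  distance less than 1 from the unit and has a square root.\<close>

lemma ex_abs_of_invertible:
  fixes y z :: "'a::unital_cstar_algebra"
  assumes sa: "star y = y" and inv: "y * z = 1" "z * y = 1"
  obtains r r' where "r * r = y * y" "star r = r" "r * r' = 1" "r' * r = 1"
    "\<And>x. x * (y * y) = y * y * x \<Longrightarrow> x * r = r * x"
proof -
  have saz: "star z = z"
    by (metis inv mult.assoc mult.left_neutral mult.right_neutral sa star_1 star_mult)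
  \<comment> \<open>Small enough that \<open>\<epsilon> *\<^sub>R (z * z)\<close> has norm below 1;
    the added 1 avoids division by zero.\<close>
  define \<epsilon> where "\<epsilon> = 1 / (norm (z * z) + 1)"
  have \<epsilon>: "\<epsilon> > 0"
    by (auto simp: \<epsilon>_def add_nonneg_pos)
  have "norm (\<epsilon> *\<^sub>R (z * z)) < 1"
    by (simp add: \<epsilon>_def add_nonneg_pos)
  moreover have "star (\<epsilon> *\<^sub>R (z * z)) = \<epsilon> *\<^sub>R (z * z)"
    by (simp add: star_mult saz)
  ultimately obtain w where w: "w * w = 1 - \<epsilon> *\<^sub>R (z * z)" "star w = w"
      "\<And>x. x * (\<epsilon> *\<^sub>R (z * z)) = \<epsilon> *\<^sub>R (z * z) * x \<Longrightarrow> x * w = w * x"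
    by (rule ex_sqrt_one_minus) blast
  have yz: "y * (z * x) = x" "z * (y * x) = x" for x
    by (simp_all add: inv flip: mult.assoc)
  have yw: "y * w = w * y"
    by (rule w(3)) (simp add: mult.assoc yz inv)
  have yyzz: "y * y * (z * z) = 1" "z * z * (y * y) = 1"
    by (simp_all add: mult.assoc yz inv)
  define h where "h = y * w"
  have sah: "star h = h"
    by (simp add: h_def star_mult sa w(2) yw)
  have "h * h = y * y * (w * w)"
    unfolding h_def by (metis mult.assoc yw)
  also have "\<dots> = y * y - \<epsilon> *\<^sub>R 1"
    by (simp add: w(1) right_diff_distrib yyzz)
  finally have hh: "h * h = y * y - \<epsilon> *\<^sub>R 1" .
  define t where "t = (norm h)\<^sup>2 + 1"
  have t: "t > 0" "(norm h)\<^sup>2 < t"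
    by (auto simp: t_def add_nonneg_pos)
  define c where "c = (1 / (t + \<epsilon>)) *\<^sub>R (t *\<^sub>R 1 - h * h)"
  have "norm c < 1"
    using norm_minus_square_le[OF sah t(2)] t \<epsilon> by (simp add: c_def divide_simps)
  moreover have "star c = c"
    by (simp add: c_def star_diff star_mult sah)
  ultimately obtain s where s: "s * s = 1 - c" "star s = s" "\<And>x. x * c = c * x \<Longrightarrow> x * s = s * x"
    by (rule ex_sqrt_one_minus) blast
  have "(t + \<epsilon>) *\<^sub>R (1 - c) = (t + \<epsilon>) *\<^sub>R 1 - (t *\<^sub>R 1 - h * h)"
    using t \<epsilon> by (simp add: c_def scaleR_diff_right)
  also have "\<dots> = y * y"
    by (simp add: hh algebra_simps)
  finally have yy: "(t + \<epsilon>) *\<^sub>R (s * s) = y * y"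
    by (simp add: s(1))
  define r where "r = sqrt (t + \<epsilon>) *\<^sub>R s"
  have rr: "r * r = y * y"
    using t \<epsilon> by (simp add: r_def yy)
  have comm: "x * r = r * x" if "x * (y * y) = y * y * x" for x
  proof -
    have "x * s = s * x"
      by (rule s(3)) (use that in \<open>simp add: c_def hh right_diff_distrib left_diff_distrib\<close>)
    then show ?thesis
      by (simp add: r_def)
  qed
  have inv_r: "r * (r * (z * z)) = 1" "z * z * r * r = 1"
    by (metis mult.assoc rr yyzz)+
  then have "z * z * r = r * (z * z)"
    by (metis mult.assoc mult.left_neutral mult.right_neutral)
  moreover have "star r = r"
    by (simp add: r_def s(2))
  ultimately show ?thesis
    using that[of r "z * z * r"] rr comm inv_r by (metis mult.assoc)
qed

section \<open>Equivalence of idempotents and of projections\<close>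

lemma is_projectionD:
  assumes "is_projection p"
  shows "p * p = p" "star p = p"
  using assms by (auto simp: is_projection_def)

text \<open>Idempotency of the sum gives \<open>p * q + q * p = 0\<close>; multiplying by
  \<open>p\<close> from either side shows that \<open>p\<close> and \<open>q\<close> commute, whence
  \<open>2 *\<^sub>R (p * q) = 0\<close>.\<close>

lemma orthogonal_projections_mult_eq_0:
  assumes "orthogonal_projections p q"
  shows "p * q = 0" "q * p = 0"
proof -
  have p: "p * p = p" and q: "q * q = q" and pq: "(p + q) * (p + q) = p + q"
    using assms by (auto simp: orthogonal_projections_def is_projection_def)
  have 0: "p * q + q * p = 0"
    using pq by (simp add: algebra_simps p q)
  have "p * (p * q + q * p) = p * q + p * (q * p)" "(p * q + q * p) * p = p * (q * p) + q * p"
    by (simp_all add: algebra_simps p) (simp_all add: p flip: mult.assoc)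
  then have "p * q = q * p"
    unfolding 0 by (simp add: add_eq_0_iff)
  with 0 have "2 *\<^sub>R (p * q) = 0"
    by (simp add: scaleR_2)
  then show "p * q = 0"
    by simp
  with \<open>p * q = q * p\<close> show "q * p = 0"
    by simp
qed

lemma orthogonal_projectionsI:
  assumes "is_projection p" "is_projection q" "p * q = 0"
  shows "orthogonal_projections p q"
proof -
  have "q * p = 0"
    using assms by (metis is_projectionD(2) star_0 star_mult)
  then show ?thesis
    using assms by (simp add: orthogonal_projections_def is_projection_def algebra_simps star_add)
qed

lemma orthogonal_projections_commute:
  "orthogonal_projections p q \<Longrightarrow> orthogonal_projections q p"
  by (simp add: orthogonal_projections_def add.commute)

text \<open>The defect \<open>?w\<close> is the star of \<open>v - v * star v * v\<close>;
  idempotency of \<open>v * star v\<close> cancels \<open>star ?w * ?w\<close>, so the C*-identity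
  makes \<open>?w\<close> vanish.\<close>

lemma projection_mult_partial_isometry:
  fixes v :: "'a::unital_cstar_algebra"
  assumes "is_projection (v * star v)"
  shows "v * star v * v = v"
proof -
  let ?w = "star v - star v * (v * star v)"
  have "star ?w * ?w = v * star v - v * star v * (v * star v) - v * star v * (v * star v)
      + v * star v * (v * star v) * (v * star v)"
    by (simp add: star_diff star_mult star_star algebra_simps)
  also have "\<dots> = 0"
    by (simp add: is_projectionD[OF assms])
  finally have "?w = 0"
    by (rule star_mult_self_eq_0)
  then have "star (star v) = star (star v * (v * star v))"
    by simp
  then show ?thesis
    by (simp add: star_star star_mult mult.assoc)
qed

lemma partial_isometry_mult_projection:
  fixes v :: "'a::unital_cstar_algebra"
  assumes "is_projection (star v * v)"
  shows "v * (star v * v) = v"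
proof -
  have "star (star v * v * star v) = star (star v)"
    using projection_mult_partial_isometry[of "star v"] assms by (simp add: star_star)
  then show ?thesis
    by (simp add: star_mult star_star)
qed

section \<open>Algebraic equivalence of idempotents\<close>

text \<open>Murray-von Neumann equivalence without the star. The last four equations cut
  \<open>a\<close> and \<open>b\<close> down to the corners between \<open>e\<close> and
  \<open>f\<close>; they force both elements to be idempotent and make cross terms vanish when
  equivalences are added.\<close>

definition alg_equiv :: "'a::unital_cstar_algebra \<Rightarrow> 'a \<Rightarrow> bool" where
  "alg_equiv e f \<longleftrightarrow>
     (\<exists>a b. a * b = e \<and> b * a = f \<and> e * a = a \<and> a * f = a \<and> f * b = b \<and> b * e = b)"

lemma alg_equivI:
  assumes "e * e = e" "f * f = f" "a * b = e" "b * a = f"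
  shows "alg_equiv e f"
  unfolding alg_equiv_def
proof (intro exI conjI)
  show "(e * a * f) * (f * b * e) = e" "(f * b * e) * (e * a * f) = f"
    using assms by (metis mult.assoc)+
qed (use assms in \<open>metis mult.assoc\<close>)+

lemma alg_equiv_sym: "alg_equiv e f \<Longrightarrow> alg_equiv f e"
  unfolding alg_equiv_def by blast

lemma alg_equiv_trans:
  assumes "alg_equiv e f" "alg_equiv f g"
  shows "alg_equiv e g"
proof -
  obtain a b where 1: "a * b = e" "b * a = f" "e * a = a" "a * f = a" "f * b = b" "b * e = b"
    using assms(1) unfolding alg_equiv_def by blast
  obtain c d where 2: "c * d = f" "d * c = g" "f * c = c" "c * g = c" "g * d = d" "d * f = d"
    using assms(2) unfolding alg_equiv_def by blast
  have "a * c * (d * b) = e" "d * b * (a * c) = g" "e * (a * c) = a * c" "a * c * g = a * c"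
      "g * (d * b) = d * b" "d * b * e = d * b"
    using 1 2 by (metis mult.assoc)+
  then show ?thesis
    unfolding alg_equiv_def by blast
qed

text \<open>The hypotheses say that left multiplications by \<open>e\<close> and \<open>f\<close>
  have equal ranges; the two elements are their own witnesses.\<close>

lemma alg_equiv_same_range:
  fixes e f :: "'a::unital_cstar_algebra"
  assumes "e * f = f" "f * e = e"
  shows "alg_equiv e f"
  by (rule alg_equivI[of _ _ f e]) (use assms in \<open>metis mult.assoc\<close>)+

lemma alg_equiv_same_kernel:
  fixes e f :: "'a::unital_cstar_algebra"
  assumes "e * f = e" "f * e = f"
  shows "alg_equiv e f"
  by (rule alg_equivI[of _ _ e f]) (use assms in \<open>metis mult.assoc\<close>)+

lemma alg_equiv_add:
  assumes 1: "alg_equiv e e'" and 2: "alg_equiv f f'"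
    and ef: "e * f = 0" "f * e = 0" and ef': "e' * f' = 0" "f' * e' = 0"
  shows "alg_equiv (e + f) (e' + f')"
proof -
  obtain a b where 1: "a * b = e" "b * a = e'" "e * a = a" "a * e' = a" "e' * b = b" "b * e = b"
    using 1 unfolding alg_equiv_def by blast
  obtain c d where 2: "c * d = f" "d * c = f'" "f * c = c" "c * f' = c" "f' * d = d" "d * f = d"
    using 2 unfolding alg_equiv_def by blast
  have "a * d = 0" "c * b = 0" "b * c = 0" "d * a = 0" "e * c = 0" "f * a = 0" "e' * d = 0" "f' * b = 0"
      "a * f' = 0" "c * e' = 0" "b * f = 0" "d * e = 0"
    using 1 2 ef ef' by (metis mult.assoc mult_zero_left mult_zero_right)+
  then have "(a + c) * (b + d) = e + f" "(b + d) * (a + c) = e' + f'"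
      "(e + f) * (a + c) = a + c" "(a + c) * (e' + f') = a + c"
      "(e' + f') * (b + d) = b + d" "(b + d) * (e + f) = b + d"
    using 1 2 by (simp_all add: distrib_left distrib_right)
  then show ?thesis
    unfolding alg_equiv_def by blast
qed

lemma alg_equiv_of_partial_isometry:
  assumes "is_projection (v * star v)" "is_projection (star v * v)"
  shows "alg_equiv (v * star v) (star v * v)"
  by (rule alg_equivI[of _ _ v "star v"]) (use assms in \<open>auto simp: is_projectionD\<close>)

text \<open>Kaplansky's formula \<open>p = e e\<^sup>* (1 + (e - e\<^sup>*) (e\<^sup>* - e))\<^sup>-\<^sup>1\<close>.\<close>

lemma ex_range_projection:
  fixes e :: "'a::unital_cstar_algebra"
  assumes e: "e * e = e"
  obtains p where "is_projection p" "p * e = e" "e * p = p"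
proof -
  define f where "f = star e"
  \<comment> \<open>The factor \<open>\<i>\<close> makes \<open>h\<close> self-adjoint, so that
    \<open>m = 1 + h * h\<close>, the bracket in Kaplansky's formula, is invertible.\<close>
  define h where "h = \<i> *\<^sub>C (e - f)"
  have f: "f * f = f"
    unfolding f_def by (metis e star_mult)
  have fe: "star e = f" "star f = e"
    by (simp_all add: f_def star_star)
  have sah: "star h = h"
    by (simp add: h_def star_scaleC star_diff fe scaleC_minus_left scaleC_diff_right)
  have hh: "h * h = - ((e - f) * (e - f))"
    by (simp add: h_def mult_scaleC_left mult_scaleC_right scaleC_scaleC scaleC_minus_left)
  define m where "m = 1 + h * h"
  have m: "m = 1 - e - f + e * f + f * e"
    by (simp add: m_def hh algebra_simps e f)
  obtain n where n: "n * m = 1" "m * n = 1"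
    unfolding m_def by (rule ex_inverse_one_plus_square[OF sah])
  have fl: "e * (e * x) = e * x" "f * (f * x) = f * x" for x
    by (simp_all add: e f flip: mult.assoc)
  \<comment> \<open>Both products equal \<open>e * f * e\<close>, so \<open>e\<close> commutes with
    \<open>m\<close> and hence with its inverse \<open>n\<close>; likewise for
    \<open>f\<close>.\<close>
  have em: "e * m = e * f * e" "m * e = e * f * e"
    by (simp_all add: m algebra_simps e f fl)
  have fm: "f * m = f * e * f" "m * f = f * e * f"
    by (simp_all add: m algebra_simps e f fl)
  have sm: "star m = m"
    by (simp add: m_def star_add star_mult sah)
  have sn: "star n = n"
    by (metis n mult.assoc mult.left_neutral mult.right_neutral sm star_1 star_mult)
  have en: "n * e = e * n"
    by (metis em mult.assoc mult.left_neutral mult.right_neutral n)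
  have fn: "n * f = f * n"
    by (metis fm mult.assoc mult.left_neutral mult.right_neutral n)
  define p where "p = e * f * n"
  have pn: "p = n * e * f"
    unfolding p_def by (metis en fn mult.assoc)
  have ep: "e * p = p"
    by (simp add: p_def e flip: mult.assoc)
  have "p * e = n * (e * f * e)"
    by (simp add: pn mult.assoc)
  also have "\<dots> = e"
    by (simp add: n flip: em(2) mult.assoc)
  finally have pe: "p * e = e" .
  have "star p = p"
    by (simp add: p_def star_mult fe sn) (metis p_def pn mult.assoc)
  moreover have "p * p = p"
    by (metis p_def pe mult.assoc)
  ultimately show ?thesis
    using that pe ep by (simp add: is_projection_def)
qed

text \<open>
  For an equivalence \<open>a\<close>, \<open>b\<close> of orthogonal projections \<open>p\<close>, \<open>q\<close> the positive element needed for the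
  polar decomposition of \<open>a\<close> is a corner of the square of the self-adjoint element
  \<open>a + a\<^sup>* + (1 - p - q)\<close>, so positivity of \<open>a\<^sup>* a\<close> in general is not needed.
\<close>

lemma orthogonal_alg_equiv_imp_partial_isometry:
  fixes p q :: "'a::unital_cstar_algebra"
  assumes p: "is_projection p" and q: "is_projection q" and pq: "p * q = 0" and equiv: "alg_equiv p q"
  obtains v where "v * star v = p" "star v * v = q"
proof -
  obtain a b where ab: "a * b = p" "b * a = q" "p * a = a" "a * q = a" "q * b = b" "b * p = b"
    using equiv unfolding alg_equiv_def by blast
  note P = is_projectionD[OF p] is_projectionD[OF q]
  define a' b' where "a' = star a" and "b' = star b"
  have st: "star a = a'" "star a' = a" "star b = b'" "star b' = b"
    by (simp_all add: a'_def b'_def star_star)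
  have qp: "q * p = 0"
    by (metis P pq star_0 star_mult)
  have ab': "b' * a' = p" "a' * b' = q" "a' * p = a'" "q * a' = a'" "b' * q = b'" "p * b' = b'"
    using ab P by (metis a'_def b'_def star_mult)+
  have Z1: "a * p = 0" "q * a = 0" "a' * q = 0" "p * a' = 0" "b * q = 0" "p * b = 0" "b' * p = 0" "q * b' = 0"
    using ab ab' pq qp by (metis mult.assoc mult_zero_left mult_zero_right)+
  have Z2: "a * a = 0" "a' * a' = 0" "b * b = 0" "b' * b' = 0"
      "a * b' = 0" "b' * a = 0" "a' * b = 0" "b * a' = 0"
    using ab ab' Z1 by (metis mult.assoc mult_zero_left mult_zero_right)+
  note T = ab ab' Z1 Z2 pq qp P
  \<comment> \<open>\<open>y\<close> exchanges \<open>p\<close> and \<open>q\<close> by means of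
    \<open>a\<close> and \<open>a'\<close> and fixes the rest; \<open>z\<close> is built in the same
    way from \<open>b\<close> and \<open>b'\<close> and inverts it.\<close>
  define y where "y = a + a' + (1 - p - q)"
  define z where "z = b + b' + (1 - p - q)"
  have yz: "y * z = 1" "z * y = 1"
    by (simp_all add: y_def z_def algebra_simps T)
  have sy: "star y = y" and sz: "star z = z"
    by (simp_all add: y_def z_def star_add star_diff st P add.commute)
  \<comment> \<open>\<open>r\<close> is the absolute value of \<open>y\<close>; since
    \<open>q * (y * y) = a' * a\<close>, the product \<open>a * r'\<close> will be the partial
    isometry in the polar decomposition of \<open>a\<close>.\<close>
  obtain r r' where r: "r * r = y * y" "star r = r" "r * r' = 1" "r' * r = 1"
    "\<And>x. x * (y * y) = y * y * x \<Longrightarrow> x * r = r * x"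
    by (rule ex_abs_of_invertible[OF sy yz]) blast
  have yy: "y * y = a * a' + a' * a + (1 - p - q)"
    by (simp add: y_def algebra_simps T)
  have T2: "q * (a * a') = 0" "q * (a' * a) = a' * a"
    by (simp_all add: T flip: mult.assoc)
  have qyy: "q * (y * y) = a' * a" "y * y * q = a' * a"
    by (simp_all add: yy algebra_simps T T2)
  then have qr: "q * r = r * q"
    by (intro r) simp
  have sr': "star r' = r'"
    by (metis r(2-4) mult.assoc mult.left_neutral mult.right_neutral star_1 star_mult)
  \<comment> \<open>The aim is \<open>r' * r' = z * z\<close>: both are the inverse of
    \<open>y * y\<close>.\<close>
  have "r' * r' = r' * r' * (y * y * (z * z))"
    by (metis yz mult.assoc mult.right_neutral)
  also have "\<dots> = z * z"
    by (metis r(1,4) mult.assoc mult.left_neutral)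
  finally have rz: "r' * r' = z * z" .
  have az: "a * z = p"
    by (simp add: z_def algebra_simps T)
  have za: "z * a' = p"
    by (metis P(2) az st(1) star_mult sz)
  show ?thesis
  proof
    have "a * r' * star (a * r') = a * (r' * r') * a'"
      by (simp add: star_mult sr' st mult.assoc)
    also have "\<dots> = p"
      by (metis P(1) az za mult.assoc rz)
    finally show "a * r' * star (a * r') = p" .
    have "star (a * r') * (a * r') = r' * (a' * a) * r'"
      by (simp add: star_mult sr' st mult.assoc)
    also have "\<dots> = r' * (q * (r * r)) * r'"
      by (simp add: qyy r(1))
    also have "\<dots> = q"
      by (metis mult.assoc mult.left_neutral mult.right_neutral qr r(3,4))
    finally show "star (a * r') * (a * r') = q" .
  qed
qed

section \<open>Grothendieck groups\<close>

locale carrier_semigroup =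
  fixes S :: "'b set" and add :: "'b \<Rightarrow> 'b \<Rightarrow> 'b"
  assumes add_closed: "a \<in> S \<Longrightarrow> b \<in> S \<Longrightarrow> add a b \<in> S"
    and add_assoc: "a \<in> S \<Longrightarrow> b \<in> S \<Longrightarrow> c \<in> S \<Longrightarrow> add (add a b) c = add a (add b c)"
    and add_commute: "a \<in> S \<Longrightarrow> b \<in> S \<Longrightarrow> add a b = add b a"
begin

lemma add_left_commute: "a \<in> S \<Longrightarrow> b \<in> S \<Longrightarrow> c \<in> S \<Longrightarrow> add a (add b c) = add b (add a c)"
  by (metis add_assoc add_commute)

lemmas add_ac = add_closed add_assoc add_commute add_left_commute

abbreviation rel where "rel \<equiv> grothendieck_rel S add"

lemma relI:
  assumes "a \<in> S" "b \<in> S" "c \<in> S" "d \<in> S" "e \<in> S" "add (add a d) e = add (add c b) e"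
  shows "((a, b), (c, d)) \<in> rel"
  using assms by (auto simp: grothendieck_rel_def)

lemma equiv_rel: "equiv (S \<times> S) rel"
proof (rule equivI)
  show "rel \<subseteq> (S \<times> S) \<times> (S \<times> S)"
    by (auto simp: grothendieck_rel_def)
  show "refl_on (S \<times> S) rel"
    by (auto simp: refl_on_def grothendieck_rel_def)
  show "sym rel"
    by (auto simp: sym_def grothendieck_rel_def) metis
  show "trans rel"
  proof (rule transI, clarify)
    fix a b c d g h assume "((a, b), (c, d)) \<in> rel" "((c, d), (g, h)) \<in> rel"
    then obtain e k where S: "a \<in> S" "b \<in> S" "c \<in> S" "d \<in> S" "g \<in> S" "h \<in> S" "e \<in> S" "k \<in> S"
      and e: "add (add a d) e = add (add c b) e" and k: "add (add c h) k = add (add g d) k"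
      by (auto simp: grothendieck_rel_def)
    \<comment> \<open>The summand \<open>d + e + k\<close> leaves room to apply both given equations
      in turn.\<close>
    have "add (add a h) (add d (add e k)) = add (add (add a d) e) (add h k)"
      using S by (simp add: add_ac)
    also have "\<dots> = add (add (add c h) k) (add b e)"
      unfolding e using S by (simp add: add_ac)
    also have "\<dots> = add (add g b) (add d (add e k))"
      unfolding k using S by (simp add: add_ac)
    finally show "((a, b), (g, h)) \<in> rel"
      using S by (intro relI[of _ _ _ _ "add d (add e k)"]) (simp_all add: add_closed)
  qed
qed

lemma class_eqI:
  assumes "a \<in> S" "b \<in> S" "c \<in> S" "d \<in> S" "e \<in> S" "add (add a d) e = add (add c b) e"
  shows "rel `` {(a, b)} = rel `` {(c, d)}"
  by (rule equiv_class_eq[OF equiv_rel relI[OF assms]])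

abbreviation K where "K \<equiv> grothendieck_group S add"

text \<open>The product does not depend on representatives, so all terms of the double union are one
  class and the union collapses to it.\<close>

lemma K_mult:
  assumes S: "a \<in> S" "b \<in> S" "c \<in> S" "d \<in> S"
  shows "(rel `` {(a, b)}) \<otimes>\<^bsub>K\<^esub> (rel `` {(c, d)}) = rel `` {(add a c, add b d)}"
proof -
  have *: "rel `` {(add a' c', add b' d')} = rel `` {(add a c, add b d)}"
    if rel: "((a, b), (a', b')) \<in> rel" "((c, d), (c', d')) \<in> rel" for a' b' c' d'
  proof -
    obtain e k where S': "a' \<in> S" "b' \<in> S" "c' \<in> S" "d' \<in> S" "e \<in> S" "k \<in> S"
      and e: "add (add a b') e = add (add a' b) e" and k: "add (add c d') k = add (add c' d) k"
      using rel by (auto simp: grothendieck_rel_def)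
    have "add (add (add a c) (add b' d')) (add e k) = add (add (add a b') e) (add (add c d') k)"
      using S S' by (simp add: add_ac)
    also have "\<dots> = add (add (add a' c') (add b d)) (add e k)"
      unfolding e k using S S' by (simp add: add_ac)
    finally show ?thesis
      using S S' by (intro class_eqI[symmetric, of _ _ _ _ "add e k"]) (simp_all add: add_closed)
  qed
  have mem: "(a, b) \<in> rel `` {(a, b)}" "(c, d) \<in> rel `` {(c, d)}"
    using S by (auto intro!: relI[where e = a])
  have "(rel `` {(a, b)}) \<otimes>\<^bsub>K\<^esub> (rel `` {(c, d)}) =
      (\<Union>x\<in>rel `` {(a, b)}. \<Union>y\<in>rel `` {(c, d)}. rel `` {(add (fst x) (fst y), add (snd x) (snd y))})"
    by (simp add: grothendieck_group_def case_prod_beta)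
  also have "\<dots> = (\<Union>x\<in>rel `` {(a, b)}. \<Union>y\<in>rel `` {(c, d)}. rel `` {(add a c, add b d)})"
    by (intro SUP_cong refl) (simp add: *)
  also have "\<dots> = rel `` {(add a c, add b d)}"
    using mem by blast
  finally show ?thesis .
qed

lemma K_one:
  assumes "s \<in> S"
  shows "\<one>\<^bsub>K\<^esub> = rel `` {(s, s)}"
proof -
  have *: "rel `` {(t, t)} = rel `` {(s, s)}" if "t \<in> S" for t
    using assms that by (intro class_eqI[where e = s]) (simp_all add: add_ac)
  have "\<one>\<^bsub>K\<^esub> = (\<Union>t\<in>S. rel `` {(t, t)})"
    by (simp add: grothendieck_group_def)
  also have "\<dots> = (\<Union>t\<in>S. rel `` {(s, s)})"
    by (intro SUP_cong refl *)
  also have "\<dots> = rel `` {(s, s)}"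
    using assms by blast
  finally show ?thesis .
qed

lemma K_carrierI: "a \<in> S \<Longrightarrow> b \<in> S \<Longrightarrow> rel `` {(a, b)} \<in> carrier K"
  by (auto simp: grothendieck_group_def intro!: quotientI)

lemma K_carrierE:
  assumes "x \<in> carrier K"
  obtains a b where "x = rel `` {(a, b)}" "a \<in> S" "b \<in> S"
  using assms by (auto simp: grothendieck_group_def elim!: quotientE)

lemma K_inverse:
  assumes "a \<in> S" "b \<in> S"
  shows "(rel `` {(b, a)}) \<otimes>\<^bsub>K\<^esub> (rel `` {(a, b)}) = \<one>\<^bsub>K\<^esub>"
  unfolding K_mult[OF assms(2,1,1,2)] K_one[OF assms(1)]
  using assms by (intro class_eqI[where e = a]) (simp_all add: add_ac)

lemma group_K:
  assumes "S \<noteq> {}"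
  shows "group K"
proof -
  obtain s where s: "s \<in> S"
    using assms by blast
  show ?thesis
  proof (rule groupI)
    show "\<one>\<^bsub>K\<^esub> \<in> carrier K"
      unfolding K_one[OF s] by (rule K_carrierI[OF s s])
    show "x \<otimes>\<^bsub>K\<^esub> y \<in> carrier K" if "x \<in> carrier K" "y \<in> carrier K" for x y
      using that by (elim K_carrierE) (simp add: K_mult K_carrierI add_closed)
    show "x \<otimes>\<^bsub>K\<^esub> y \<otimes>\<^bsub>K\<^esub> z = x \<otimes>\<^bsub>K\<^esub> (y \<otimes>\<^bsub>K\<^esub> z)"
      if "x \<in> carrier K" "y \<in> carrier K" "z \<in> carrier K" for x y z
      using that by (elim K_carrierE) (simp add: K_mult add_closed add_assoc)
    show "\<one>\<^bsub>K\<^esub> \<otimes>\<^bsub>K\<^esub> x = x" if x: "x \<in> carrier K" for x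
    proof -
      obtain a b where ab: "x = rel `` {(a, b)}" "a \<in> S" "b \<in> S"
        using x by (rule K_carrierE)
      then show ?thesis
        unfolding ab(1) K_one[OF s] K_mult[OF s s ab(2,3)] using s
        by (intro class_eqI[where e = s]) (simp_all add: add_ac)
    qed
    show "\<exists>y\<in>carrier K. y \<otimes>\<^bsub>K\<^esub> x = \<one>\<^bsub>K\<^esub>" if x: "x \<in> carrier K" for x
    proof -
      obtain a b where ab: "x = rel `` {(a, b)}" "a \<in> S" "b \<in> S"
        using x by (rule K_carrierE)
      then show ?thesis
        by (intro bexI[of _ "rel `` {(b, a)}"]) (simp_all add: K_inverse K_carrierI)
    qed
  qed
qed

text \<open>Reduces the group expression in the index to the class of one pair, so that equality of
  indices becomes a semigroup equation up to a common summand.\<close>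

lemma K_difference:
  assumes a: "a \<in> S" and b: "b \<in> S"
  shows "grothendieck_class S add a \<otimes>\<^bsub>K\<^esub> inv\<^bsub>K\<^esub> grothendieck_class S add b = rel `` {(a, b)}"
proof -
  have aa: "add a a \<in> S" and bb: "add b b \<in> S"
    using a b by (auto intro: add_closed)
  interpret K: group K
    using a by (intro group_K) blast
  have "inv\<^bsub>K\<^esub> (rel `` {(add b b, b)}) = rel `` {(b, add b b)}"
    using b bb by (intro K.inv_equality K_inverse) (simp_all add: K_carrierI)
  then have "grothendieck_class S add a \<otimes>\<^bsub>K\<^esub> inv\<^bsub>K\<^esub> grothendieck_class S add b =
      rel `` {(add (add a a) b, add a (add b b))}"
    by (simp add: grothendieck_class_def K_mult[OF aa a b bb])
  also have "\<dots> = rel `` {(a, b)}"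
    using a b by (intro class_eqI[where e = a]) (simp_all add: add_ac)
  finally show ?thesis .
qed

end

section \<open>The semigroup of projections in an ideal of finite type\<close>

text \<open>The approximate unit is brought in by \<open>approximate_unit_common\<close>, which
  keeps its index type out of the locale.\<close>

locale finite_type =
  fixes \<F> :: "'a::unital_cstar_algebra set"
  assumes ideal: "selfadjoint_ideal \<F>"
    and ex_orthogonal_copy: "p \<in> Proj \<F> \<Longrightarrow> q \<in> Proj \<F> \<Longrightarrow>
      \<exists>v. v * star v = q \<and> orthogonal_projections (star v * v) p"
begin

lemma ideal_add: "x \<in> \<F> \<Longrightarrow> y \<in> \<F> \<Longrightarrow> x + y \<in> \<F>"
  and ideal_mult_left: "x \<in> \<F> \<Longrightarrow> a * x \<in> \<F>"
  and ideal_mult_right: "x \<in> \<F> \<Longrightarrow> x * a \<in> \<F>"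
  using ideal by (auto simp: selfadjoint_ideal_def)

lemma ideal_diff: "x \<in> \<F> \<Longrightarrow> y \<in> \<F> \<Longrightarrow> x - y \<in> \<F>"
  using ideal_add[of x "y * (- 1)"] ideal_mult_right[of y "- 1"] by simp

lemma ProjD:
  assumes "p \<in> Proj \<F>"
  shows "p \<in> \<F>" "is_projection p"
  using assms by (auto simp: Proj_def)

lemma Proj_add:
  assumes "p \<in> Proj \<F>" "q \<in> Proj \<F>" "orthogonal_projections p q"
  shows "p + q \<in> Proj \<F>"
  using assms by (auto simp: Proj_def orthogonal_projections_def ideal_add)

lemma proj_equivI:
  assumes "p \<in> Proj \<F>" "q \<in> Proj \<F>" "v * star v = p" "star v * v = q"
  shows "(p, q) \<in> proj_equiv \<F>"
  using assms by (auto simp: proj_equiv_def)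

lemma proj_equivE:
  assumes "(p, q) \<in> proj_equiv \<F>"
  obtains v where "p \<in> Proj \<F>" "q \<in> Proj \<F>" "v * star v = p" "star v * v = q"
    "p * v = v" "v * q = v"
proof -
  obtain v where v: "p \<in> Proj \<F>" "q \<in> Proj \<F>" "v * star v = p" "star v * v = q"
    using assms by (auto simp: proj_equiv_def)
  moreover have "p * v = v" "v * q = v"
    using projection_mult_partial_isometry[of v] partial_isometry_mult_projection[of v] v ProjD(2)
    by auto
  ultimately show ?thesis
    by (rule that)
qed

lemma equiv_proj_equiv: "equiv (Proj \<F>) (proj_equiv \<F>)"
proof (rule equivI)
  show "proj_equiv \<F> \<subseteq> Proj \<F> \<times> Proj \<F>"
    by (auto simp: proj_equiv_def)
  show "refl_on (Proj \<F>) (proj_equiv \<F>)"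
  proof (rule refl_onI)
    fix p assume "p \<in> Proj \<F>"
    then show "(p, p) \<in> proj_equiv \<F>"
      using ProjD(2)[of p] by (intro proj_equivI[of _ _ p]) (auto simp: is_projection_def)
  qed
  show "sym (proj_equiv \<F>)"
    by (rule symI) (metis proj_equivE proj_equivI star_star)
  show "trans (proj_equiv \<F>)"
  proof (rule transI)
    fix p q r assume "(p, q) \<in> proj_equiv \<F>" "(q, r) \<in> proj_equiv \<F>"
    then obtain v w where p: "p \<in> Proj \<F>" and r: "r \<in> Proj \<F>"
      and v: "v * star v = p" "star v * v = q" "v * q = v"
      and w: "w * star w = q" "star w * w = r" "q * w = w"
      by (elim proj_equivE) blast
    have "v * w * star (v * w) = v * (w * star w) * star v"
      by (simp add: star_mult mult.assoc)
    then have 1: "v * w * star (v * w) = p"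
      by (simp add: v w)
    have "star (v * w) * (v * w) = star w * (star v * v * w)"
      by (simp add: star_mult mult.assoc)
    then have "star (v * w) * (v * w) = r"
      by (simp add: v w)
    with 1 p r show "(p, r) \<in> proj_equiv \<F>"
      by (intro proj_equivI)
  qed
qed

section \<open>Orthogonal copies and addition of classes\<close>

text \<open>The copy lies in \<open>\<F>\<close> although \<open>v\<close> need not:
  \<open>star v * v = star v * q * v\<close>, and \<open>\<F>\<close> is an ideal.\<close>

lemma ex_equiv_orthogonal:
  assumes "p \<in> Proj \<F>" "q \<in> Proj \<F>"
  obtains q' where "(q, q') \<in> proj_equiv \<F>" "q' \<in> Proj \<F>" "orthogonal_projections p q'"
proof -
  obtain v where v: "v * star v = q" "orthogonal_projections (star v * v) p"
    using ex_orthogonal_copy assms by blast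
  then have p': "is_projection (star v * v)"
    by (simp add: orthogonal_projections_def)
  have "star v * v = star v * q * v"
    using partial_isometry_mult_projection[OF p'] v(1) by (metis mult.assoc)
  then have "star v * v \<in> \<F>"
    using ProjD(1)[OF assms(2)] by (metis ideal_mult_left ideal_mult_right)
  with p' have "star v * v \<in> Proj \<F>"
    by (simp add: Proj_def)
  then show ?thesis
    using that v assms by (auto intro: proj_equivI orthogonal_projections_commute)
qed

lemma proj_equiv_imp_alg_equiv:
  assumes "(p, q) \<in> proj_equiv \<F>"
  shows "alg_equiv p q"
  using assms by (elim proj_equivE) (metis ProjD(2) alg_equiv_of_partial_isometry)

text \<open>The polar decomposition above is for orthogonal projections, so \<open>p\<close> is
  first moved to a copy \<open>p'\<close> orthogonal to \<open>q\<close>.\<close>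

lemma alg_equiv_imp_proj_equiv:
  assumes p: "p \<in> Proj \<F>" and q: "q \<in> Proj \<F>" and pq: "alg_equiv p q"
  shows "(p, q) \<in> proj_equiv \<F>"
proof -
  obtain p' where p': "(p, p') \<in> proj_equiv \<F>" "p' \<in> Proj \<F>" "orthogonal_projections q p'"
    using ex_equiv_orthogonal[OF q p] .
  have "alg_equiv p' q"
    using alg_equiv_trans[OF alg_equiv_sym[OF proj_equiv_imp_alg_equiv[OF p'(1)]] pq] .
  then obtain v where "v * star v = p'" "star v * v = q"
    using orthogonal_alg_equiv_imp_partial_isometry[of p' q] p' q ProjD(2)
      orthogonal_projections_mult_eq_0(2)[OF p'(3)] by blast
  then have "(p', q) \<in> proj_equiv \<F>"
    using p' q by (intro proj_equivI)
  with p'(1) show ?thesis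
    using equiv_proj_equiv by (meson equivE transE)
qed

abbreviation cls where "cls p \<equiv> proj_equiv \<F> `` {p}"

lemma cls_eqI:
  assumes "p \<in> Proj \<F>" "q \<in> Proj \<F>" "alg_equiv p q"
  shows "cls p = cls q"
  by (rule equiv_class_eq[OF equiv_proj_equiv alg_equiv_imp_proj_equiv[OF assms]])

lemma cls_in_S_carrier: "p \<in> Proj \<F> \<Longrightarrow> cls p \<in> S_carrier \<F>"
  by (simp add: S_carrier_def quotientI)

lemma S_carrierE:
  assumes "X \<in> S_carrier \<F>"
  obtains p where "X = cls p" "p \<in> Proj \<F>"
  using assms by (auto simp: S_carrier_def elim: quotientE)

text \<open>Lets sums of classes be computed with orthogonal idempotents in place of projections.
  All orthogonal representatives give one class, so the union in \<open>S_add\<close> collapses; it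
  is nonempty by \<open>ex_equiv_orthogonal\<close>.\<close>

lemma S_add_cls:
  assumes P: "P \<in> Proj \<F>" "Q \<in> Proj \<F>" "R \<in> Proj \<F>"
    and equiv: "alg_equiv P e" "alg_equiv Q f" "alg_equiv R (e + f)"
    and 0: "e * f = 0" "f * e = 0"
  shows "S_add \<F> (cls P) (cls Q) = cls R"
proof -
  have sum: "cls (p + q) = cls R"
    if pq: "(P, p) \<in> proj_equiv \<F>" "(Q, q) \<in> proj_equiv \<F>" "orthogonal_projections p q" for p q
  proof -
    have "alg_equiv p e" "alg_equiv q f"
      using proj_equiv_imp_alg_equiv[OF pq(1)] proj_equiv_imp_alg_equiv[OF pq(2)] equiv
      by (blast intro: alg_equiv_sym alg_equiv_trans)+
    then have "alg_equiv (p + q) (e + f)"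
      using alg_equiv_add orthogonal_projections_mult_eq_0[OF pq(3)] 0 by blast
    then have "alg_equiv (p + q) R"
      using equiv(3) by (blast intro: alg_equiv_sym alg_equiv_trans)
    moreover have "p + q \<in> Proj \<F>"
      using pq by (elim proj_equivE) (rule Proj_add)
    ultimately show ?thesis
      using P(3) by (intro cls_eqI)
  qed
  obtain q where q: "(Q, q) \<in> proj_equiv \<F>" "orthogonal_projections P q"
    using ex_equiv_orthogonal[OF P(1,2)] by blast
  have "P \<in> cls P"
    using equiv_class_self[OF equiv_proj_equiv P(1)] .
  have "S_add \<F> (cls P) (cls Q) = (\<Union>p\<in>cls P. \<Union>q\<in>{q \<in> cls Q. orthogonal_projections p q}. cls R)"
    unfolding S_add_def by (intro SUP_cong refl) (simp add: sum)
  also have "\<dots> = cls R"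
    using q \<open>P \<in> cls P\<close> by blast
  finally show ?thesis .
qed

lemma alg_equiv_refl: "is_projection p \<Longrightarrow> alg_equiv p p"
  by (rule alg_equiv_same_range) (simp_all add: is_projection_def)

lemma S_add_cls_orthogonal:
  assumes "p \<in> Proj \<F>" "q \<in> Proj \<F>" "orthogonal_projections p q"
  shows "S_add \<F> (cls p) (cls q) = cls (p + q)"
  by (rule S_add_cls[OF assms(1,2) Proj_add[OF assms] _ _ _ orthogonal_projections_mult_eq_0[OF assms(3)]])
    (intro alg_equiv_refl ProjD(2) Proj_add assms)+

lemma cls_orthogonal_representative:
  assumes "p \<in> Proj \<F>" "X \<in> S_carrier \<F>"
  obtains q where "X = cls q" "q \<in> Proj \<F>" "orthogonal_projections p q"
proof -
  obtain q where q: "X = cls q" "q \<in> Proj \<F>"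
    using assms(2) by (rule S_carrierE)
  obtain q' where q': "(q, q') \<in> proj_equiv \<F>" "q' \<in> Proj \<F>" "orthogonal_projections p q'"
    using ex_equiv_orthogonal[OF assms(1) q(2)] .
  then show ?thesis
    using that q equiv_class_eq[OF equiv_proj_equiv] by metis
qed

sublocale S: carrier_semigroup "S_carrier \<F>" "S_add \<F>"
proof
  fix X Y assume X: "X \<in> S_carrier \<F>" and Y: "Y \<in> S_carrier \<F>"
  obtain p where p: "X = cls p" "p \<in> Proj \<F>"
    using X by (rule S_carrierE)
  obtain q where q: "Y = cls q" "q \<in> Proj \<F>" "orthogonal_projections p q"
    using p(2) Y by (rule cls_orthogonal_representative)
  have XY: "S_add \<F> X Y = cls (p + q)"
    unfolding p q using p q by (intro S_add_cls_orthogonal)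
  show "S_add \<F> X Y \<in> S_carrier \<F>"
    unfolding XY using p q by (intro cls_in_S_carrier Proj_add)
  show "S_add \<F> X Y = S_add \<F> Y X"
    unfolding XY unfolding p(1) q(1) using S_add_cls_orthogonal[OF q(2) p(2) orthogonal_projections_commute[OF q(3)]]
    by (simp add: add.commute)
  fix Z assume Z: "Z \<in> S_carrier \<F>"
  have pq: "p + q \<in> Proj \<F>"
    using p q by (intro Proj_add)
  obtain r where r: "Z = cls r" "r \<in> Proj \<F>" "orthogonal_projections (p + q) r"
    using pq Z by (rule cls_orthogonal_representative)
  note 0 = orthogonal_projections_mult_eq_0[OF q(3)] orthogonal_projections_mult_eq_0[OF r(3)]
  note sq = is_projectionD(1)[OF ProjD(2)[OF p(2)]] is_projectionD(1)[OF ProjD(2)[OF q(2)]]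
  \<comment> \<open>Multiplying \<open>(p + q) * r = 0\<close> by \<open>p\<close> and by
    \<open>q\<close> makes \<open>r\<close> orthogonal to each summand; associativity then reduces
    to that of addition in the algebra.\<close>
  have "p * ((p + q) * r) = p * r" "q * ((p + q) * r) = q * r"
    by (simp_all add: 0 sq distrib_left distrib_right flip: mult.assoc)
  then have pr: "p * r = 0" and qr: "q * r = 0"
    by (simp_all add: 0)
  have qr': "orthogonal_projections q r"
    using q r qr by (intro orthogonal_projectionsI ProjD)
  then have qr2: "q + r \<in> Proj \<F>"
    using q r by (intro Proj_add)
  have "orthogonal_projections p (q + r)"
    using p qr2 by (intro orthogonal_projectionsI ProjD) (simp_all add: distrib_left 0 pr)
  then have "S_add \<F> X (S_add \<F> Y Z) = cls (p + (q + r))"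
    unfolding p(1) q(1) r(1) using p q r qr' qr2 by (simp add: S_add_cls_orthogonal)
  moreover have "S_add \<F> (S_add \<F> X Y) Z = cls (p + q + r)"
    unfolding XY r(1) using pq r by (intro S_add_cls_orthogonal)
  ultimately show "S_add \<F> (S_add \<F> X Y) Z = S_add \<F> X (S_add \<F> Y Z)"
    by (simp add: add.assoc)
qed

lemma idempotent_equiv_Proj:
  assumes "e \<in> \<F>" "e * e = e"
  obtains p where "p \<in> Proj \<F>" "alg_equiv p e"
proof -
  obtain p where p: "is_projection p" "p * e = e" "e * p = p"
    using ex_range_projection[OF assms(2)] .
  then have "p \<in> \<F>"
    using ideal_mult_right[OF assms(1), of p] by simp
  then show ?thesis
    using that[of p] p by (simp add: Proj_def alg_equiv_same_range)
qed

end

section \<open>Decompositions and idempotents\<close>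

text \<open>It suffices to split the unit as \<open>m + n\<close>: then
  \<open>x = m * x + n * x\<close> is the splitting of every \<open>x\<close>, so \<open>n\<close>
  is the idempotent.\<close>

lemma direct_decomposition_idempotent:
  assumes "direct_decomposition M N"
  obtains e where "e * e = e" "N = {x. e * x = x}" "M = {x. e * x = 0}"
proof -
  have M: "closed_submodule M" and N: "closed_submodule N" and MN: "M \<inter> N = {0}"
    and sum: "{m + n | m n. m \<in> M \<and> n \<in> N} = UNIV"
    using assms by (auto simp: direct_decomposition_def)
  have diff: "x - y \<in> L" if "closed_submodule L" "x \<in> L" "y \<in> L" for L and x y :: 'a
  proof -
    have "y * (- 1) \<in> L"
      using that unfolding closed_submodule_def by blast
    then have "x + y * (- 1) \<in> L"
      using that unfolding closed_submodule_def by blast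
    then show ?thesis
      by simp
  qed
  have mult: "x * a \<in> L" if "closed_submodule L" "x \<in> L" for L and x a :: 'a
    using that unfolding closed_submodule_def by blast
  have "1 \<in> {m + n | m n. m \<in> M \<and> n \<in> N}"
    unfolding sum by simp
  then obtain m n where mn: "1 = m + n" "m \<in> M" "n \<in> N"
    by blast
  have x: "x = m * x + n * x" for x
    using mn(1) by (metis distrib_right mult.left_neutral)
  have N': "n * x = x" if "x \<in> N" for x
  proof -
    have "m * x = x - n * x"
      using x[of x] by (metis add_diff_cancel_right')
    then have "m * x \<in> M \<inter> N"
      using diff[OF N that mult[OF N mn(3)]] mult[OF M mn(2)] by (metis IntI)
    then show ?thesis
      using x[of x] MN by simp
  qed
  have M': "n * x = 0" if "x \<in> M" for x
  proof -
    have "n * x = x - m * x"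
      using x[of x] by (metis add_diff_cancel_left')
    then have "n * x \<in> M \<inter> N"
      using diff[OF M that mult[OF M mn(2)]] mult[OF N mn(3)] by (metis IntI)
    then show ?thesis
      using MN by simp
  qed
  show ?thesis
  proof
    show "n * n = n"
      using N' mn by blast
    show "N = {x. n * x = x}"
      using N' mult[OF N mn(3)] by (auto, metis)
    show "M = {x. n * x = 0}"
      using M' mult[OF M mn(2)] x by (auto, metis add.right_neutral)
  qed
qed

lemma left_mult_module_operator: "left_mult (a::'a::unital_cstar_algebra) \<in> module_operators"
  by (simp add: module_operators_def left_mult_def mult_scaleC_right mult.assoc bounded_linear_mult_right)

lemma operator_element_left_mult [simp]: "operator_element (left_mult (a::'a::unital_cstar_algebra)) = a"
proof -
  have "inj (left_mult :: 'a \<Rightarrow> 'a \<Rightarrow> 'a)"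
    by (rule injI) (metis left_mult_def mult.right_neutral)
  then show ?thesis
    by (simp add: operator_element_def the_inv_f_f)
qed

text \<open>For the uniqueness demanded by \<open>THE\<close>, the difference of two candidates lies
  in \<open>N\<close> and is orthogonal to itself, so it vanishes.\<close>

lemma orth_proj_eq_left_mult:
  fixes p :: "'a::unital_cstar_algebra"
  assumes p: "is_projection p" and N: "N = {x. p * x = x}"
  shows "orth_proj N = left_mult p"
  unfolding orth_proj_def
proof (rule the_equality)
  note P = is_projectionD[OF p]
  have "star y * (x - p * x) = 0" if "p * y = y" for x y
  proof -
    have "star y * p = star y"
      by (metis P(2) star_mult that)
    then show ?thesis
      by (simp add: right_diff_distrib flip: mult.assoc)
  qed
  then show "left_mult p \<in> module_operators \<and>
      (\<forall>x. left_mult p x \<in> N \<and> (\<forall>y\<in>N. module_inner y (x - left_mult p x) = 0))"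
    by (simp add: left_mult_module_operator N module_inner_def)
      (simp add: left_mult_def P flip: mult.assoc)
  fix T assume T: "T \<in> module_operators \<and> (\<forall>x. T x \<in> N \<and> (\<forall>y\<in>N. module_inner y (x - T x) = 0))"
  show "T = left_mult p"
  proof
    fix x
    let ?y = "T x - p * x"
    have "p * ?y = ?y"
      using T by (simp add: N right_diff_distrib P flip: mult.assoc)
    then have "star ?y * (x - T x) = 0" "star ?y * (x - p * x) = 0"
      using T \<open>\<And>y x. p * y = y \<Longrightarrow> star y * (x - p * x) = 0\<close> by (simp_all add: N module_inner_def)
    then have "star ?y * ((x - p * x) - (x - T x)) = 0"
      by (simp only: right_diff_distrib[of "star ?y" "x - p * x"] diff_self)
    moreover have "(x - p * x) - (x - T x) = ?y"
      by (simp add: algebra_simps)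
    ultimately have "?y = 0"
      by (metis star_mult_self_eq_0)
    then show "T x = left_mult p x"
      by (simp add: left_mult_def)
  qed
qed

section \<open>Well-definedness of the index\<close>

context finite_type
begin

section \<open>The algebraic form of a decomposition and its compression\<close>

text \<open>The range projection \<open>p\<close> of \<open>e\<close> also has range
  \<open>N\<close>, so it is the element behind \<open>orth_proj N\<close>; then
  \<open>e = p * e\<close> puts \<open>e\<close> into the ideal.\<close>

lemma orth_proj_idempotent:
  assumes e: "e * e = e" and N: "N = {x. e * x = x}" and "orth_proj N \<in> left_mult ` \<F>"
  obtains p where "p \<in> Proj \<F>" "operator_element (orth_proj N) = p" "alg_equiv p e" "e \<in> \<F>"
proof -
  obtain p where p: "is_projection p" "p * e = e" "e * p = p"
    using ex_range_projection[OF e] .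
  have "N = {x. p * x = x}"
    unfolding N using p by (metis mult.assoc)
  then have op: "orth_proj N = left_mult p"
    using p by (intro orth_proj_eq_left_mult)
  then have "p \<in> \<F>"
    using assms(3) by (metis image_iff operator_element_left_mult)
  moreover have "e \<in> \<F>"
    using ideal_mult_right[OF \<open>p \<in> \<F>\<close>, of e] p by simp
  ultimately show ?thesis
    using that[of p] p op by (simp add: Proj_def alg_equiv_same_range)
qed

text \<open>All module data become ring elements: \<open>F\<close> is left multiplication by
  \<open>F 1\<close>, each idempotent projects onto its \<open>N\<close> along its \<open>M\<close>,
  and \<open>g\<close> inverts \<open>F\<close> on \<open>M\<^sub>2\<close> and vanishes on
  \<open>N\<^sub>2\<close>.\<close>

lemma MKPhi_decomposition_elements:
  assumes F: "F \<in> module_operators" and dec: "MKPhi_decomposition \<F> F M\<^sub>1 N\<^sub>1 M\<^sub>2 N\<^sub>2"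
  obtains e\<^sub>1 e\<^sub>2 g p\<^sub>1 p\<^sub>2 where "e\<^sub>1 \<in> \<F>" "e\<^sub>1 * e\<^sub>1 = e\<^sub>1" "e\<^sub>2 \<in> \<F>" "e\<^sub>2 * e\<^sub>2 = e\<^sub>2"
    "g * F 1 = 1 - e\<^sub>1" "F 1 * g = 1 - e\<^sub>2" "e\<^sub>1 * g = 0" "g * e\<^sub>2 = 0"
    "p\<^sub>1 \<in> Proj \<F>" "alg_equiv p\<^sub>1 e\<^sub>1" "p\<^sub>2 \<in> Proj \<F>" "alg_equiv p\<^sub>2 e\<^sub>2"
    "MKPhi_index \<F> N\<^sub>1 N\<^sub>2 = S.rel `` {(cls p\<^sub>1, cls p\<^sub>2)}"
proof -
  have bij: "bij_betw F M\<^sub>1 M\<^sub>2" and FN: "F ` N\<^sub>1 \<subseteq> N\<^sub>2"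
    and dd: "direct_decomposition M\<^sub>1 N\<^sub>1" "direct_decomposition M\<^sub>2 N\<^sub>2"
    and op: "orth_proj N\<^sub>1 \<in> left_mult ` \<F>" "orth_proj N\<^sub>2 \<in> left_mult ` \<F>"
    using dec by (auto simp: MKPhi_decomposition_def)
  define f where "f = F 1"
  have "F (1 * x) = F 1 * x" for x
    using F unfolding module_operators_def by blast
  then have Ff: "F x = f * x" for x
    unfolding f_def by (metis mult.left_neutral)
  obtain e\<^sub>1 where e1: "e\<^sub>1 * e\<^sub>1 = e\<^sub>1" "N\<^sub>1 = {x. e\<^sub>1 * x = x}" "M\<^sub>1 = {x. e\<^sub>1 * x = 0}"
    using dd(1) by (rule direct_decomposition_idempotent)
  obtain e\<^sub>2 where e2: "e\<^sub>2 * e\<^sub>2 = e\<^sub>2" "N\<^sub>2 = {x. e\<^sub>2 * x = x}" "M\<^sub>2 = {x. e\<^sub>2 * x = 0}"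
    using dd(2) by (rule direct_decomposition_idempotent)
  obtain p\<^sub>1 where p1: "p\<^sub>1 \<in> Proj \<F>" "operator_element (orth_proj N\<^sub>1) = p\<^sub>1" "alg_equiv p\<^sub>1 e\<^sub>1" "e\<^sub>1 \<in> \<F>"
    using e1(1,2) op(1) by (rule orth_proj_idempotent)
  obtain p\<^sub>2 where p2: "p\<^sub>2 \<in> Proj \<F>" "operator_element (orth_proj N\<^sub>2) = p\<^sub>2" "alg_equiv p\<^sub>2 e\<^sub>2" "e\<^sub>2 \<in> \<F>"
    using e2(1,2) op(2) by (rule orth_proj_idempotent)
  have inj: "x = y" if "f * x = f * y" "e\<^sub>1 * x = 0" "e\<^sub>1 * y = 0" for x y
    using bij_betw_imp_inj_on[OF bij] that unfolding e1(3) inj_on_def Ff by blast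
  \<comment> \<open>The preimage in \<open>M\<^sub>1\<close> of the component of 1 in
    \<open>M\<^sub>2\<close> serves as \<open>g\<close>.\<close>
  have "1 - e\<^sub>2 \<in> F ` M\<^sub>1"
    unfolding bij_betw_imp_surj_on[OF bij] by (simp add: e2 right_diff_distrib)
  then obtain g where g: "f * g = 1 - e\<^sub>2" "e\<^sub>1 * g = 0"
    by (auto simp: Ff e1(3))
  have "F (1 - e\<^sub>1) \<in> M\<^sub>2"
    by (rule bij_betwE[OF bij, rule_format]) (simp add: e1 right_diff_distrib)
  then have fe1: "e\<^sub>2 * (f * (1 - e\<^sub>1)) = 0"
    by (simp add: Ff e2)
  have "F e\<^sub>1 \<in> N\<^sub>2"
    using FN e1 by blast
  then have fe1': "e\<^sub>2 * (f * e\<^sub>1) = f * e\<^sub>1"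
    by (simp add: Ff e2)
  have ge2: "g * e\<^sub>2 = 0"
  proof (rule inj)
    show "f * (g * e\<^sub>2) = f * 0" "e\<^sub>1 * (g * e\<^sub>2) = 0"
      by (simp_all add: g left_diff_distrib e2 flip: mult.assoc)
  qed simp
  \<comment> \<open>The product \<open>g * f\<close> is determined on both summands: on
    \<open>M\<^sub>1\<close> by injectivity of \<open>F\<close>, on \<open>N\<^sub>1\<close> because
    \<open>f\<close> sends it into \<open>N\<^sub>2\<close>, which \<open>g\<close>
    annihilates.\<close>
  have "g * f * (1 - e\<^sub>1) = 1 - e\<^sub>1"
  proof (rule inj)
    have "f * (g * f * (1 - e\<^sub>1)) = (1 - e\<^sub>2) * (f * (1 - e\<^sub>1))"
      by (simp add: g flip: mult.assoc)
    also have "\<dots> = f * (1 - e\<^sub>1)"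
      by (simp only: left_diff_distrib[of 1 e\<^sub>2] fe1) simp
    finally show "f * (g * f * (1 - e\<^sub>1)) = f * (1 - e\<^sub>1)" .
    show "e\<^sub>1 * (g * f * (1 - e\<^sub>1)) = 0"
      by (simp add: g flip: mult.assoc)
    show "e\<^sub>1 * (1 - e\<^sub>1) = 0"
      by (simp add: right_diff_distrib e1)
  qed
  moreover have "g * f * e\<^sub>1 = 0"
    by (metis fe1' ge2 mult.assoc mult_zero_left)
  ultimately have gf: "g * f = 1 - e\<^sub>1"
    by (simp add: right_diff_distrib)
  have "MKPhi_index \<F> N\<^sub>1 N\<^sub>2 = S.rel `` {(cls p\<^sub>1, cls p\<^sub>2)}"
    unfolding MKPhi_index_def K_class_def K_group_def p1(2) p2(2)
    by (intro S.K_difference cls_in_S_carrier p1 p2)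
  then show ?thesis
    using that e1(1) e2(1) g gf ge2 p1 p2 unfolding f_def by blast
qed

text \<open>
  Here \<open>p\<close> is so large that \<open>f\<close> is bounded below on \<open>(1 - p) \<A>\<close>; \<open>k\<close> is the complement of an
  idempotent onto \<open>f (1 - p) \<A>\<close>, and \<open>d\<close> is an idempotent whose range complements
  \<open>(1 - e\<^sub>1) (1 - p) \<A>\<close> in \<open>M\<^sub>1 = (1 - e\<^sub>1) \<A>\<close>. The range of \<open>1 - k\<close> depends on \<open>f\<close> and \<open>p\<close> only,
  which allows us to compare two decompositions.
\<close>

lemma compare_with_compression:
  fixes f g e\<^sub>1 e\<^sub>2 p :: 'a
  assumes e1: "e\<^sub>1 \<in> \<F>" "e\<^sub>1 * e\<^sub>1 = e\<^sub>1" and e2: "e\<^sub>2 \<in> \<F>" "e\<^sub>2 * e\<^sub>2 = e\<^sub>2"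
    and gf: "g * f = 1 - e\<^sub>1" and fg: "f * g = 1 - e\<^sub>2" and e1g: "e\<^sub>1 * g = 0" and ge2: "g * e\<^sub>2 = 0"
    and p: "p \<in> \<F>" "p * p = p" and small: "norm (p * e\<^sub>1 - e\<^sub>1) < 1"
  obtains d d' k u where
    "d \<in> \<F>" "d * d = d" "d * e\<^sub>1 = 0" "e\<^sub>1 * d = 0" "alg_equiv p (d + e\<^sub>1)"
    "d' * e\<^sub>2 = 0" "e\<^sub>2 * d' = 0" "alg_equiv d d'" "k \<in> \<F>" "k * k = k" "alg_equiv k (d' + e\<^sub>2)"
    "k * (f * (1 - p)) = 0" "1 - k = f * (1 - p) * u"
proof -
  define E where "E = 1 - e\<^sub>1"
  define q where "q = 1 - p"
  have EE: "E * E = E" and qq: "q * q = q"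
    by (simp_all add: E_def q_def algebra_simps e1 p)
  \<comment> \<open>\<open>c\<close> measures how far \<open>E\<close> is from the identity on the
    range of \<open>q\<close>: \<open>q * E * q = (1 - c) * q\<close>.\<close>
  define c where "c = q * e\<^sub>1"
  have "norm c < 1"
    using small by (simp add: c_def q_def left_diff_distrib norm_minus_commute)
  then obtain s where s: "s * (1 - c) = 1" "(1 - c) * s = 1"
    by (rule ex_inverse_one_minus)
  have pc: "p * c = 0" "q * c = c"
    by (simp_all add: c_def q_def left_diff_distrib right_diff_distrib p flip: mult.assoc)
  have "p * ((1 - c) * s) = p * s"
    by (simp add: right_diff_distrib pc flip: mult.assoc)
  then have ps: "p * s = p"
    by (simp add: s)
  \<comment> \<open>\<open>t\<close> is the inverse of \<open>q * E * q\<close> in the corner cut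
    out by \<open>q\<close>.\<close>
  define t where "t = s * q"
  have qt: "q * t = t" and tq: "t * q = t"
  proof -
    have "p * (s * q) = 0"
      by (simp add: ps q_def right_diff_distrib p flip: mult.assoc)
    then show "q * t = t"
      by (simp add: t_def q_def left_diff_distrib)
    show "t * q = t"
      by (simp add: t_def qq mult.assoc)
  qed
  have qEq: "q * E * q = (1 - c) * q"
    by (simp add: E_def c_def right_diff_distrib left_diff_distrib qq)
  have "t * E * q = s * (q * E * q)"
    by (simp add: t_def mult.assoc)
  then have tEq: "t * E * q = q"
    unfolding qEq by (simp add: s flip: mult.assoc)
  have "q * E * t = q * E * (q * t)"
    by (simp only: qt)
  then have "q * E * t = (1 - c) * (q * t)"
    by (metis mult.assoc qEq)
  then have qEt: "q * E * t = q"
    by (simp add: qt) (simp add: t_def s flip: mult.assoc)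
  have tEt: "t * E * t = t"
    by (metis mult.assoc qEt tq)
  \<comment> \<open>\<open>j\<close> projects onto the range of \<open>q\<close> and
    \<open>r\<close> onto that of \<open>E * q\<close>, with the same kernel. Hence
    \<open>1 - j\<close> shares its kernel with \<open>p\<close> and its range with
    \<open>1 - r\<close>.\<close>
  define j where "j = t * E"
  define r where "r = E * t * E"
  have jj: "j * j = j" and jr: "j * r = j" and rj: "r * j = r" and rr: "r * r = r"
    unfolding j_def r_def by (metis EE mult.assoc tEt)+
  have jq: "j * q = q" and qj: "q * j = j"
    unfolding j_def by (metis mult.assoc tEq qt)+
  have Er: "E * r = r" and rE: "r * E = r" and jE: "j * E = j"
    unfolding r_def j_def by (metis EE mult.assoc)+
  have pj: "p * (1 - j) = p" "(1 - j) * p = 1 - j"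
  proof -
    have "p * j = 0"
      using qj by (simp add: q_def left_diff_distrib)
    then show "p * (1 - j) = p"
      by (simp add: right_diff_distrib)
    have "(1 - j) * (1 - q) = 1 - j"
      by (simp add: left_diff_distrib right_diff_distrib jq)
    then show "(1 - j) * p = 1 - j"
      by (simp add: q_def)
  qed
  have jr1: "(1 - j) * (1 - r) = 1 - r" "(1 - r) * (1 - j) = 1 - j"
    by (simp_all add: left_diff_distrib right_diff_distrib jr rj)
  define d where "d = E - r"
  have dE: "d * E = d" and Ed: "E * d = d" and dd: "d * d = d"
    by (simp_all add: d_def left_diff_distrib right_diff_distrib EE Er rE rr)
  have de1: "d * e\<^sub>1 = 0" "e\<^sub>1 * d = 0"
    using dE Ed by (simp_all add: E_def left_diff_distrib right_diff_distrib)
  have d_e1: "d + e\<^sub>1 = 1 - r"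
    by (simp add: d_def E_def)
  have "alg_equiv p (1 - j)" "alg_equiv (1 - j) (1 - r)"
    using alg_equiv_same_kernel[OF pj] alg_equiv_same_range[OF jr1] .
  then have p_equiv: "alg_equiv p (d + e\<^sub>1)"
    unfolding d_e1 by (rule alg_equiv_trans)
  have "1 - j \<in> \<F>"
    using ideal_mult_left[OF p(1), of "1 - j"] by (simp only: pj)
  then have "1 - r \<in> \<F>"
    using ideal_mult_right[of "1 - j" "1 - r"] by (simp only: jr1)
  then have dF: "d \<in> \<F>"
    using ideal_diff[OF _ e1(1)] d_e1 by (metis add_diff_cancel_right')
  define d' where "d' = f * d * g"
  have "d' * e\<^sub>2 = 0"
    by (simp add: d'_def mult.assoc ge2)
  have e2': "e\<^sub>2 = 1 - f * g"
    by (simp add: fg)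
  have gf_left: "g * (f * x) = E * x" for x
    by (simp add: E_def gf flip: mult.assoc)
  have "e\<^sub>2 * d' = f * (d * g) - f * (E * d * g)"
    unfolding e2' d'_def by (simp add: left_diff_distrib mult.assoc gf_left)
  then have "e\<^sub>2 * d' = 0"
    by (simp add: Ed mult.assoc)
  have "d' * d' = f * (d * (E * d) * g)"
    by (simp add: d'_def mult.assoc gf_left)
  then have "d' * d' = d'"
    by (simp add: Ed dd d'_def mult.assoc)
  moreover have "d * g * (f * d) = d" "f * d * (d * g) = d'"
    by (simp_all add: mult.assoc gf_left Ed dd d'_def) (simp add: dd flip: mult.assoc)
  ultimately have "alg_equiv d d'"
    using dd by (intro alg_equivI)
  \<comment> \<open>As \<open>g * f = E\<close> and both \<open>j\<close> and \<open>r\<close>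
    absorb \<open>E\<close> on the right, sending \<open>x\<close> to \<open>f * x * g\<close>
    respects their products; \<open>\<epsilon>\<close> and \<open>\<tau>\<close> inherit the
    relations between \<open>j\<close> and \<open>r\<close>.\<close>
  define \<epsilon> where "\<epsilon> = f * j * g"
  define \<tau> where "\<tau> = f * r * g"
  have Eg: "E * g = g"
    by (simp add: E_def left_diff_distrib e1g)
  have d'_e2: "d' + e\<^sub>2 = 1 - \<tau>"
    by (simp add: d'_def d_def \<tau>_def left_diff_distrib right_diff_distrib mult.assoc Eg fg)
  have j_left: "j * (E * x) = j * x" "j * (j * x) = j * x" "j * (r * x) = j * x"
    and r_left: "r * (E * x) = r * x" "r * (j * x) = r * x" for x
    by (simp_all add: jE jj jr rE rj flip: mult.assoc)
  have \<epsilon>\<epsilon>: "\<epsilon> * \<epsilon> = \<epsilon>" and \<epsilon>\<tau>: "\<epsilon> * \<tau> = \<epsilon>" and \<tau>\<epsilon>: "\<tau> * \<epsilon> = \<tau>"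
    by (simp_all add: \<epsilon>_def \<tau>_def mult.assoc gf_left j_left r_left)
  define k where "k = 1 - \<epsilon>"
  have kk: "k * k = k"
    by (simp add: k_def left_diff_distrib right_diff_distrib \<epsilon>\<epsilon>)
  have k\<tau>: "k * (1 - \<tau>) = 1 - \<tau>" "(1 - \<tau>) * k = k"
    by (simp_all add: k_def left_diff_distrib right_diff_distrib \<epsilon>\<tau> \<tau>\<epsilon>)
  then have k_equiv: "alg_equiv k (d' + e\<^sub>2)"
    unfolding d'_e2 by (rule alg_equiv_same_range)
  have "d' + e\<^sub>2 \<in> \<F>"
    unfolding d'_def using dF e2(1) by (intro ideal_add ideal_mult_right ideal_mult_left)
  then have "k \<in> \<F>"
    using ideal_mult_right[of "d' + e\<^sub>2" k] by (simp only: d'_e2 k\<tau>)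
  have "k * (f * q) = 0"
    by (simp add: k_def \<epsilon>_def left_diff_distrib mult.assoc gf_left j_left jq)
  moreover have "1 - k = f * q * (j * g)"
    by (simp add: k_def \<epsilon>_def mult.assoc) (simp add: qj flip: mult.assoc)
  ultimately show ?thesis
    using that[of d d' k "j * g"] dF dd de1 p_equiv \<open>d' * e\<^sub>2 = 0\<close> \<open>e\<^sub>2 * d' = 0\<close> \<open>alg_equiv d d'\<close>
      \<open>k \<in> \<F>\<close> kk k_equiv unfolding q_def by blast
qed

lemma cls_eq_S_add:
  assumes "P \<in> Proj \<F>" "alg_equiv P (d + e)" "p \<in> Proj \<F>" "alg_equiv p e"
    "D \<in> Proj \<F>" "alg_equiv D d" "d * e = 0" "e * d = 0"
  shows "cls P = S_add \<F> (cls D) (cls p)"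
  using assms by (intro S_add_cls[symmetric])

end

lemma finite_type_ideal_imp_finite_type:
  assumes "finite_type_ideal TYPE('i) \<F>"
  shows "finite_type \<F>"
  using assms by unfold_locales (auto simp: finite_type_ideal_def Proj_def)

text \<open>Directedness supplies one index beyond both thresholds; \<open>a\<close> and
  \<open>b\<close> will be the idempotents \<open>e\<^sub>1\<close> and \<open>e\<^sub>1'\<close> of
  the two decompositions.\<close>

lemma approximate_unit_common:
  assumes "finite_type_ideal TYPE('i) \<F>" and "a \<in> \<F>" "b \<in> \<F>"
  obtains p where "p \<in> Proj \<F>" "norm (p * a - a) < 1" "norm (p * b - b) < 1"
proof -
  obtain I :: "'i set" and leq p where "projection_approximate_unit \<F> I leq p"
    using assms(1) by (auto simp: finite_type_ideal_def)
  then have dir: "directed_on I leq" and p: "\<And>i. i \<in> I \<Longrightarrow> p i \<in> Proj \<F>"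
    and lim: "\<And>a. a \<in> \<F> \<Longrightarrow> net_tendsto_zero I leq (\<lambda>i. norm (p i * a - a))"
    by (auto simp: projection_approximate_unit_def Proj_def)
  have ex: "\<exists>i\<^sub>0\<in>I. \<forall>i\<in>I. leq i\<^sub>0 i \<longrightarrow> norm (p i * a - a) < 1" if "a \<in> \<F>" for a
    using lim[OF that] unfolding net_tendsto_zero_def by (metis abs_norm_cancel zero_less_one)
  obtain i j where "i \<in> I" "\<forall>k\<in>I. leq i k \<longrightarrow> norm (p k * a - a) < 1"
    "j \<in> I" "\<forall>k\<in>I. leq j k \<longrightarrow> norm (p k * b - b) < 1"
    using ex assms(2,3) by blast
  moreover from this obtain k where "k \<in> I" "leq i k" "leq j k"
    using dir unfolding directed_on_def by blast
  ultimately show ?thesis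
    using that[of "p k"] p by blast
qed

theorem theorem2p9:
  fixes \<F> :: "'a::unital_cstar_algebra set"
    and F :: "'a \<Rightarrow> 'a"
    and M\<^sub>1 N\<^sub>1 M\<^sub>2 N\<^sub>2 M\<^sub>1' N\<^sub>1' M\<^sub>2' N\<^sub>2' :: "'a set"
  assumes "finite_type_ideal TYPE('i) \<F>"
    and "F \<in> MKPhi \<F>"
    and "MKPhi_decomposition \<F> F M\<^sub>1 N\<^sub>1 M\<^sub>2 N\<^sub>2"
    and "MKPhi_decomposition \<F> F M\<^sub>1' N\<^sub>1' M\<^sub>2' N\<^sub>2'"
  shows "MKPhi_index \<F> N\<^sub>1 N\<^sub>2 = MKPhi_index \<F> N\<^sub>1' N\<^sub>2'"
proof -
  interpret finite_type \<F>
    using assms(1) by (rule finite_type_ideal_imp_finite_type)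
  have F: "F \<in> module_operators"
    using assms(2) by (simp add: MKPhi_def)
  obtain e\<^sub>1 e\<^sub>2 g p\<^sub>1 p\<^sub>2 where
    e: "e\<^sub>1 \<in> \<F>" "e\<^sub>1 * e\<^sub>1 = e\<^sub>1" "e\<^sub>2 \<in> \<F>" "e\<^sub>2 * e\<^sub>2 = e\<^sub>2"
      "g * F 1 = 1 - e\<^sub>1" "F 1 * g = 1 - e\<^sub>2" "e\<^sub>1 * g = 0" "g * e\<^sub>2 = 0"
    and p: "p\<^sub>1 \<in> Proj \<F>" "alg_equiv p\<^sub>1 e\<^sub>1" "p\<^sub>2 \<in> Proj \<F>" "alg_equiv p\<^sub>2 e\<^sub>2"
    and index: "MKPhi_index \<F> N\<^sub>1 N\<^sub>2 = S.rel `` {(cls p\<^sub>1, cls p\<^sub>2)}"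
    using F assms(3) by (rule MKPhi_decomposition_elements)
  obtain e\<^sub>1' e\<^sub>2' g' p\<^sub>1' p\<^sub>2' where
    e': "e\<^sub>1' \<in> \<F>" "e\<^sub>1' * e\<^sub>1' = e\<^sub>1'" "e\<^sub>2' \<in> \<F>" "e\<^sub>2' * e\<^sub>2' = e\<^sub>2'"
      "g' * F 1 = 1 - e\<^sub>1'" "F 1 * g' = 1 - e\<^sub>2'" "e\<^sub>1' * g' = 0" "g' * e\<^sub>2' = 0"
    and p': "p\<^sub>1' \<in> Proj \<F>" "alg_equiv p\<^sub>1' e\<^sub>1'" "p\<^sub>2' \<in> Proj \<F>" "alg_equiv p\<^sub>2' e\<^sub>2'"
    and index': "MKPhi_index \<F> N\<^sub>1' N\<^sub>2' = S.rel `` {(cls p\<^sub>1', cls p\<^sub>2')}"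
    using F assms(4) by (rule MKPhi_decomposition_elements)
  obtain P where P: "P \<in> Proj \<F>" "norm (P * e\<^sub>1 - e\<^sub>1) < 1" "norm (P * e\<^sub>1' - e\<^sub>1') < 1"
    using assms(1) e(1) e'(1) by (rule approximate_unit_common)
  note PP = ProjD(1)[OF P(1)] is_projectionD(1)[OF ProjD(2)[OF P(1)]]
  obtain d d\<^sub>2 k u where
    d: "d \<in> \<F>" "d * d = d" "d * e\<^sub>1 = 0" "e\<^sub>1 * d = 0" "alg_equiv P (d + e\<^sub>1)"
      "d\<^sub>2 * e\<^sub>2 = 0" "e\<^sub>2 * d\<^sub>2 = 0" "alg_equiv d d\<^sub>2" "k \<in> \<F>" "k * k = k" "alg_equiv k (d\<^sub>2 + e\<^sub>2)"
      "k * (F 1 * (1 - P)) = 0" "1 - k = F 1 * (1 - P) * u"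
    using e PP P(2) by (rule compare_with_compression)
  obtain d' d\<^sub>2' k' u' where
    d': "d' \<in> \<F>" "d' * d' = d'" "d' * e\<^sub>1' = 0" "e\<^sub>1' * d' = 0" "alg_equiv P (d' + e\<^sub>1')"
      "d\<^sub>2' * e\<^sub>2' = 0" "e\<^sub>2' * d\<^sub>2' = 0" "alg_equiv d' d\<^sub>2'" "k' \<in> \<F>" "k' * k' = k'"
      "alg_equiv k' (d\<^sub>2' + e\<^sub>2')" "k' * (F 1 * (1 - P)) = 0" "1 - k' = F 1 * (1 - P) * u'"
    using e' PP P(3) by (rule compare_with_compression)
  \<comment> \<open>\<open>1 - k\<close> and \<open>1 - k'\<close> both factor through
    \<open>F 1 * (1 - P)\<close>, which \<open>k\<close> and \<open>k'\<close> annihilate; so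
    \<open>k\<close> and \<open>k'\<close> have the same kernel.\<close>
  have "k * (1 - k') = 0" "k' * (1 - k) = 0"
    unfolding d(13) d'(13) by (simp_all add: d(12) d'(12) flip: mult.assoc[of _ "F 1 * (1 - P)"])
  then have kk': "alg_equiv k k'"
    by (intro alg_equiv_same_kernel) (simp_all add: right_diff_distrib)
  obtain Q where Q: "Q \<in> Proj \<F>" "alg_equiv Q k"
    using d(9,10) by (rule idempotent_equiv_Proj)
  obtain D where D: "D \<in> Proj \<F>" "alg_equiv D d"
    using d(1,2) by (rule idempotent_equiv_Proj)
  obtain D' where D': "D' \<in> Proj \<F>" "alg_equiv D' d'"
    using d'(1,2) by (rule idempotent_equiv_Proj)
  define x x' y y' z z' where "x = cls p\<^sub>1" and "x' = cls p\<^sub>1'" and "y = cls p\<^sub>2" and "y' = cls p\<^sub>2'"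
    and "z = cls D" and "z' = cls D'"
  have "cls P = S_add \<F> z x"
    unfolding z_def x_def using P(1) d(5) p(1,2) D d(3,4) by (rule cls_eq_S_add)
  moreover have "cls P = S_add \<F> z' x'"
    unfolding z'_def x'_def using P(1) d'(5) p'(1,2) D' d'(3,4) by (rule cls_eq_S_add)
  ultimately have 1: "S_add \<F> z x = S_add \<F> z' x'"
    by simp
  \<comment> \<open>\<open>Q\<close> represents \<open>k\<close> and, through \<open>kk'\<close>,
    also \<open>k'\<close>; \<open>D\<close> represents \<open>d\<close> and hence its transport
    \<open>d\<^sub>2\<close>.\<close>
  have "cls Q = S_add \<F> z y"
    unfolding z_def y_def
    using Q(1) alg_equiv_trans[OF Q(2) d(11)] p(3,4) D(1) alg_equiv_trans[OF D(2) d(8)] d(6,7)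
    by (rule cls_eq_S_add)
  moreover have "cls Q = S_add \<F> z' y'"
    unfolding z'_def y'_def
    using Q(1) alg_equiv_trans[OF alg_equiv_trans[OF Q(2) kk'] d'(11)] p'(3,4) D'(1)
      alg_equiv_trans[OF D'(2) d'(8)] d'(6,7)
    by (rule cls_eq_S_add)
  ultimately have 2: "S_add \<F> z y = S_add \<F> z' y'"
    by simp
  have S: "x \<in> S_carrier \<F>" "x' \<in> S_carrier \<F>" "y \<in> S_carrier \<F>" "y' \<in> S_carrier \<F>"
      "z \<in> S_carrier \<F>" "z' \<in> S_carrier \<F>"
    unfolding x_def x'_def y_def y'_def z_def z'_def using p p' D D' by (blast intro: cls_in_S_carrier)+
  \<comment> \<open>Regrouping lets \<open>1\<close> and \<open>2\<close> exchange primed and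
    unprimed terms; the sum of \<open>z\<close> and \<open>z'\<close> remains as the common summand
    that the Grothendieck relation permits.\<close>
  have "S_add \<F> (S_add \<F> x y') (S_add \<F> z z') = S_add \<F> (S_add \<F> z x) (S_add \<F> z' y')"
    using S by (simp add: S.add_ac)
  also have "\<dots> = S_add \<F> (S_add \<F> z' x') (S_add \<F> z y)"
    by (simp only: 1 2)
  also have "\<dots> = S_add \<F> (S_add \<F> x' y) (S_add \<F> z z')"
    using S by (simp add: S.add_ac)
  finally have "S.rel `` {(x, y)} = S.rel `` {(x', y')}"
    using S by (intro S.class_eqI[where e = "S_add \<F> z z'"] S.add_closed)
  then show ?thesis
    unfolding index index' x_def x'_def y_def y'_def .
qed

end
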